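(* Let $p=1/3$ and let $\{X^t,y^t,\breve y^t,z^t\}$ be generated by OADMM-EP (defined in the context). Then $$\frac1T\sum_{t=1}^T \mathrm{Crit}(X^{t+1},\breve y^{t+1},z^{t+1})\le \mathcal O(T^{(p-1)/2})+\mathcal O(T^{-p})=\mathcal O(T^{-1/3}),$$ i.e. there is a constant $C$ independent of $T$ such that the left-hand side is at most $C\,T^{-1/3}$ for all integers $T\ge 1$. In other words, for $\epsilon>0$ there exists $\bar t\le T$ (with $\bar t\in\{1,\dots,T\}$) such that $\mathrm{Crit}(X^{\bar t+1},\breve y^{\bar t+1},z^{\bar t+1})\le\epsilon$, provided that $T\ge \mathcal O(1/\epsilon^3)$, i.e. $T\ge C'/\epsilon^3$ for a constant $C'$ independent of $\epsilon$ and $T$.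
   Context: Problem: $\mathcal M=\{X\in\mathbb R^{n\times r}: X^{\mathsf T}X=I_r\}$, $n\ge r$; minimize $F(X)=f(X)-g(X)+h(\mathcal A(X))$ over $X\in\mathcal M$, where $\mathcal A:\mathbb R^{n\times r}\to\mathbb R^m$ is linear with adjoint $\mathcal A^{\mathsf T}$ and $\overline{A}=\max_{V\neq0}\|\mathcal A(V)\|/\|V\|_F$. Standing assumptions: $f$ is differentiable with $\|\nabla f(X)-\nabla f(X')\|_F\le L_f\|X-X'\|_F$ for all $X,X'\in\mathbb R^{n\times r}$, and $\|\nabla f(X)\|_F\le C_f$ for $X\in\mathcal M$; $g$ is convex, proper and $C_g$-Lipschitz; $h$ is proper, lower semicontinuous, $C_h$-Lipschitz and $W_h$-weakly convex with $W_h\ge0$ (i.e. $h+\frac{W_h}{2}\|\cdot\|_2^2$ is convex); the proximal operator of $h$ can be computed exactly. Notation: $\partial$ is the (limiting) subdifferential; $\iota_{\mathcal M}$ is the indicator function of $\mathcal M$; for a set $S$, $\|S\|=\inf_{s\in S}\|s\|$. Moreau envelope: $h_\mu(y)=\min_{v} h(v)+\frac1{2\mu}\|v-y\|_2^2$. $S(X,y,z,\beta)=f(X)+\langle z,\mathcal A(X)-y\rangle+\frac\beta2\|\mathcal A(X)-y\|_2^2$. $\ell(\beta)=\beta\overline A^2+L_f$. Parameters: $p,\xi\in(0,1)$, $\theta>1$, $\sigma\in[1,2)$, $\tau\ge\frac{4}{2-\sigma}$, $\beta^0>0$ with $\beta^0\ge 2\tau W_h$, $\alpha\in[0,\frac{\theta-1}{(\theta+1)(\xi+2)})$.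 OADMM-EP: start from $X^{-1}=X^0\in\mathcal M$, $y^0,z^0\in\mathbb R^m$. For $t=0,1,2,\dots$: (S1) $\beta^t=\beta^0(1+\xi t^p)$, $\mu^t=\tau/\beta^t$. (S2) $X_c^t=X^t+\alpha(X^t-X^{t-1})$; choose $G^t\in\nabla_X S(X_c^t,y^t,z^t,\beta^t)-\partial g(X^t)$; $X^{t+1}\in\arg\min_{X\in\mathcal M}\langle X-X^t,G^t\rangle+\frac{\theta\ell(\beta^t)}2\|X-X_c^t\|_F^2$. (S3) $b=y^t-\frac1{\beta^t}\nabla_yS(X^{t+1},y^t,z^t,\beta^t)$; $y^{t+1}=\arg\min_y h_{\mu^t}(y)+\frac{\beta^t}2\|y-b\|_2^2$, equivalently $\breve y^{t+1}=\arg\min_{v}h(v)+\frac{1}{2(\mu^t+1/\beta^t)}\|v-b\|_2^2$ and $y^{t+1}=\frac{\breve y^{t+1}+\mu^t\beta^tb}{1+\mu^t\beta^t}$. (S4) $z^{t+1}=z^t+\sigma\beta^t(\mathcal A(X^{t+1})-y^{t+1})$. Stationarity measure: $\mathrm{Crit}(X,y,z)=\|\mathcal A(X)-y\|+\|\partial h(y)-z\|+\|\mathrm{Proj}_{T_X\mathcal M}(\nabla f(X)-\partial g(X)+\mathcal A^{\mathsf T}(z))\|_F$, where $\mathrm{Proj}_{T_X\mathcal M}(\Delta)=\Delta-\frac12X(\Delta^{\mathsf T}X+X^{\mathsf T}\Delta)$ for $X\in\mathcal M$. *)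

theory Defs
  imports "HOL-Analysis.Analysis"
begin

text \<open>
  An $n \times r$ real matrix is an element of \<open>real ^ 'r ^ 'n\<close>; on this type \<open>norm\<close> and
  \<open>inner\<close> are the Frobenius norm and inner product.
\<close>

definition stiefel :: "(real ^ 'r ^ 'n) set" where
  "stiefel = {X. transpose X ** X = mat 1}"

text \<open>Orthogonal projection onto the tangent space of the Stiefel manifold at \<open>X\<close>
  (for \<open>X \<in> stiefel\<close>).\<close>

definition proj_tangent ::
  "real ^ 'r ^ 'n \<Rightarrow> real ^ 'r ^ 'n \<Rightarrow> real ^ 'r ^ 'n" where
  "proj_tangent X D = D - (1/2) *\<^sub>R (X ** (transpose D ** X + transpose X ** D))"

definition gradient :: "('a::real_inner \<Rightarrow> real) \<Rightarrow> 'a \<Rightarrow> 'a" where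
  "gradient F x = (THE D. GDERIV F x :> D)"

definition frechet_subdiff :: "('a::euclidean_space \<Rightarrow> real) \<Rightarrow> 'a \<Rightarrow> 'a set" where
  "frechet_subdiff F x =
     {v. 0 \<le> Liminf (at x) (\<lambda>w. ereal ((F w - F x - v \<bullet> (w - x)) / norm (w - x)))}"

definition limiting_subdiff :: "('a::euclidean_space \<Rightarrow> real) \<Rightarrow> 'a \<Rightarrow> 'a set" where
  "limiting_subdiff F x =
     {v. \<exists>xs vs. xs \<longlonglongrightarrow> x \<and> (\<lambda>k. F (xs k)) \<longlonglongrightarrow> F x \<and>
           (\<forall>k. vs k \<in> frechet_subdiff F (xs k)) \<and> vs \<longlonglongrightarrow> v}"

text \<open>The value of \<open>set_norm\<close> on the empty set is unspecified.\<close>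

definition set_norm :: "'a::real_normed_vector set \<Rightarrow> real" where
  "set_norm S = (INF s\<in>S. norm s)"

definition weakly_convex :: "real \<Rightarrow> ('a::real_inner \<Rightarrow> real) \<Rightarrow> bool" where
  "weakly_convex W F \<longleftrightarrow> convex_on UNIV (\<lambda>x. F x + W / 2 * (norm x)\<^sup>2)"

definition moreau_env :: "real \<Rightarrow> ('a::real_inner \<Rightarrow> real) \<Rightarrow> 'a \<Rightarrow> real" where
  "moreau_env \<mu> F y = (INF v. F v + 1 / (2 * \<mu>) * (norm (v - y))\<^sup>2)"

text \<open>The smooth part of the augmented Lagrangian.\<close>

definition aug_smooth ::
  "(real ^ 'r ^ 'n \<Rightarrow> real) \<Rightarrow> (real ^ 'r ^ 'n \<Rightarrow> real ^ 'm) \<Rightarrow>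
   real ^ 'r ^ 'n \<Rightarrow> real ^ 'm \<Rightarrow> real ^ 'm \<Rightarrow> real \<Rightarrow> real" where
  "aug_smooth f A X y z \<beta> =
     f X + z \<bullet> (A X - y) + \<beta> / 2 * (norm (A X - y))\<^sup>2"

definition Crit ::
  "(real ^ 'r ^ 'n \<Rightarrow> real) \<Rightarrow> (real ^ 'r ^ 'n \<Rightarrow> real) \<Rightarrow> (real ^ 'm \<Rightarrow> real) \<Rightarrow>
   (real ^ 'r ^ 'n \<Rightarrow> real ^ 'm) \<Rightarrow>
   real ^ 'r ^ 'n \<Rightarrow> real ^ 'm \<Rightarrow> real ^ 'm \<Rightarrow> real" where
  "Crit f g h A X y z =
     norm (A X - y)
     + set_norm ((\<lambda>v. v - z) ` limiting_subdiff h y)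
     + set_norm ((\<lambda>v. proj_tangent X (gradient f X - v + adjoint A z)) ` limiting_subdiff g X)"

definition penalty :: "real \<Rightarrow> real \<Rightarrow> real \<Rightarrow> nat \<Rightarrow> real" where
  "penalty \<beta>0 \<xi> p t = \<beta>0 * (1 + \<xi> * real t powr p)"

text \<open>
  \<open>oadmm_ep \<dots> X y yb z\<close> says that the sequences \<open>X\<close>, \<open>y\<close>, \<open>yb\<close> (that is, $\breve y$) and \<open>z\<close>
  are a run of OADMM-EP. Since subtraction on \<open>nat\<close> truncates, \<open>X (t - 1)\<close> at \<open>t = 0\<close> is
  \<open>X 0\<close>, which is the initialisation $X^{-1} = X^0$. The entry \<open>yb 0\<close> is irrelevant.
\<close>

definition oadmm_ep ::
  "(real ^ 'r ^ 'n \<Rightarrow> real) \<Rightarrow> (real ^ 'r ^ 'n \<Rightarrow> real) \<Rightarrow> (real ^ 'm \<Rightarrow> real) \<Rightarrow>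
   (real ^ 'r ^ 'n \<Rightarrow> real ^ 'm) \<Rightarrow>
   real \<Rightarrow> real \<Rightarrow> real \<Rightarrow> real \<Rightarrow> real \<Rightarrow> real \<Rightarrow> real \<Rightarrow> real \<Rightarrow>
   (nat \<Rightarrow> real ^ 'r ^ 'n) \<Rightarrow> (nat \<Rightarrow> real ^ 'm) \<Rightarrow> (nat \<Rightarrow> real ^ 'm) \<Rightarrow>
   (nat \<Rightarrow> real ^ 'm) \<Rightarrow> bool" where
  "oadmm_ep f g h A Lf p \<xi> \<theta> \<sigma> \<tau> \<beta>0 \<alpha> X y yb z \<longleftrightarrow>
     X 0 \<in> stiefel \<and>
     (\<forall>t. let \<beta> = penalty \<beta>0 \<xi> p t;
              \<mu> = \<tau> / \<beta>;
              L = \<beta> * (onorm A)\<^sup>2 + Lf;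
              Xc = X t + \<alpha> *\<^sub>R (X t - X (t - 1));
              b = y t - (1 / \<beta>) *\<^sub>R gradient (\<lambda>u. aug_smooth f A (X (t + 1)) u (z t) \<beta>) (y t)
          in (\<exists>v \<in> limiting_subdiff g (X t).
                let G = gradient (\<lambda>U. aug_smooth f A U (y t) (z t) \<beta>) Xc - v
                in is_arg_min (\<lambda>U. (U - X t) \<bullet> G + \<theta> * L / 2 * (norm (U - Xc))\<^sup>2)
                     (\<lambda>U. U \<in> stiefel) (X (t + 1))) \<and>
             is_arg_min (\<lambda>u. moreau_env \<mu> h u + \<beta> / 2 * (norm (u - b))\<^sup>2)
               (\<lambda>u. True) (y (t + 1)) \<and>
             is_arg_min (\<lambda>v. h v + 1 / (2 * (\<mu> + 1 / \<beta>)) * (norm (v - b))\<^sup>2)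
               (\<lambda>v. True) (yb (t + 1)) \<and>
             z (t + 1) = z t + (\<sigma> * \<beta>) *\<^sub>R (A (X (t + 1)) - y (t + 1)))"

end

theory Submission
  imports Defs
begin

text \<open>
  The proof follows a Lyapunov function along the run and reads the stationarity measure off its
  losses.

  The \<open>y\<close> step minimises the Moreau envelope of \<open>h\<close> plus a quadratic. Its minimiser has a closed
  form through the proximal point \<open>yb\<close> (\<open>moreau_env_minimizer_eq\<close>), and there the vector
  \<open>w = z + \<beta> (A X - y)\<close> of the full dual step is a subgradient of \<open>h\<close> at \<open>yb\<close>
  (\<open>multiplier_subgradient\<close>). Since \<open>h\<close> is Lipschitz, \<open>w\<close> is bounded, hence so is \<open>z\<close>, which
  moves towards \<open>w\<close> with relaxation \<open>\<sigma> < 2\<close>. Consequently the residual \<open>A X - y\<close> and the smoothing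
  error \<open>yb - y\<close> are of order \<open>1 / \<beta>\<close>. Moreover \<open>w\<close> is a Lipschitz function of \<open>y\<close>, up to the change
  of the smoothing parameter (\<open>prox_multiplier_lipschitz\<close>).

  The Lyapunov function is the augmented Lagrangian plus a momentum term, a multiple of the
  squared dual change and multiples of \<open>1 / \<beta>\<close>. The \<open>X\<close> step lowers it by the model decrease \<open>gap\<close>
  and by a multiple of \<open>L d\<^sup>2\<close>, where \<open>d\<close> is the step length (\<open>X_descent\<close>); the bound on \<open>\<alpha>\<close> makes
  this outweigh the momentum of the next step. The \<open>y\<close> step lowers it by \<open>3/8 \<beta> |\<Delta>y|\<^sup>2\<close>
  (\<open>y_descent\<close>), which pays for the ascent \<open>|\<Delta>z|\<^sup>2 / (\<sigma> \<beta>)\<close> of the dual step because \<open>\<tau>\<close> is large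
  (\<open>dual_change_le\<close>). Raising the penalty costs a telescoping multiple of \<open>1 / \<beta> t - 1 / \<beta> (t + 1)\<close>
  (\<open>parameter_change_le\<close>). Compactness of the manifold bounds the function below, so the losses
  have a bounded sum (\<open>loss_sum_bounded\<close>).

  Two points need care. First, the measure involves a subgradient of \<open>g\<close> at the new point,
  whereas the step towards that point uses one at the old point. So the projected gradient at
  \<open>X (t + 1)\<close> is compared with the model of the following step, which uses a subgradient at
  \<open>X (t + 1)\<close>. Second, that model may be linear, when \<open>A = 0\<close> and \<open>f\<close> is affine, and then step lengths
  are not controlled. The projected gradient is therefore bounded by the decrease of the model:
  moving along a Cayley curve on the manifold would decrease it by a multiple of the squared
  projected gradient (\<open>norm_proj_tangent_le_decrease\<close>).

  As a result the measure at step \<open>t\<close> is at most of order \<open>1 / \<beta> t\<close> plus square roots of \<open>\<beta> t\<close> times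
  losses (\<open>Crit_le_loss\<close>). As \<open>\<beta> t\<close> grows like \<open>t powr (1/3)\<close>, the first part sums to order
  \<open>T powr (2/3)\<close>, and so does the second by weighting the factors of each product with
  \<open>T powr (-2/3)\<close> (\<open>Crit_sum_le\<close>). Division by \<open>T\<close> gives the rate.
\<close>

section \<open>Subgradients\<close>

text \<open>A quadratic minorant touching \<open>F\<close> at \<open>x\<close> gives difference quotients that are bounded below
  by a multiple of \<open>- norm (w - x)\<close>, so its slope is already a Frechet subgradient.\<close>

lemma quadratic_minorant_in_limiting_subdiff:
  fixes F :: "'a::euclidean_space \<Rightarrow> real"
  assumes minorant: "\<And>u. F x + v \<bullet> (u - x) - W / 2 * (norm (u - x))\<^sup>2 \<le> F u"
  shows "v \<in> limiting_subdiff F x"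
proof -
  have "((\<lambda>w. - (W / 2) * norm (w - x)) \<longlongrightarrow> - (W / 2) * norm (x - x)) (at x)"
    by (intro tendsto_intros)
  then have lim: "((\<lambda>w. ereal (- (W / 2) * norm (w - x))) \<longlongrightarrow> 0) (at x)"
    by (simp add: zero_ereal_def)
  have "Liminf (at x) (\<lambda>w. ereal (- (W / 2) * norm (w - x))) = 0"
    by (rule lim_imp_Liminf[OF _ lim]) simp
  moreover have "Liminf (at x) (\<lambda>w. ereal (- (W / 2) * norm (w - x)))
      \<le> Liminf (at x) (\<lambda>w. ereal ((F w - F x - v \<bullet> (w - x)) / norm (w - x)))"
  proof (rule Liminf_mono)
    show "\<forall>\<^sub>F w in at x. ereal (- (W / 2) * norm (w - x))
        \<le> ereal ((F w - F x - v \<bullet> (w - x)) / norm (w - x))"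
      unfolding eventually_at_filter
    proof (rule always_eventually, intro allI impI)
      fix w assume "w \<noteq> x"
      then have "- (W / 2) * norm (w - x) * norm (w - x) \<le> F w - F x - v \<bullet> (w - x)"
        using minorant[of w] by (simp add: power2_eq_square algebra_simps)
      then show "ereal (- (W / 2) * norm (w - x))
          \<le> ereal ((F w - F x - v \<bullet> (w - x)) / norm (w - x))"
        using \<open>w \<noteq> x\<close> by (simp add: pos_le_divide_eq)
    qed
  qed
  ultimately have "v \<in> frechet_subdiff F x"
    by (simp add: frechet_subdiff_def)
  then show ?thesis
    unfolding limiting_subdiff_def mem_Collect_eq
    by (intro exI[of _ "\<lambda>_. x"] exI[of _ "\<lambda>_. v"]) simp
qed

lemma frechet_subgradient_convex:
  fixes g :: "'a::euclidean_space \<Rightarrow> real"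
  assumes "convex_on UNIV g" and "v \<in> frechet_subdiff g x"
  shows "g x + v \<bullet> (u - x) \<le> g u"
proof (rule ccontr)
  assume neg: "\<not> ?thesis"
  then have ux: "u \<noteq> x" by auto
  define c where "c = (g x + v \<bullet> (u - x) - g u) / norm (u - x)"
  have c: "c > 0" using neg ux by (simp add: c_def)
  have "0 \<le> Liminf (at x) (\<lambda>w. ereal ((g w - g x - v \<bullet> (w - x)) / norm (w - x)))"
    using assms(2) by (simp add: frechet_subdiff_def)
  then have "\<forall>\<^sub>F w in at x. ereal (- c) < ereal ((g w - g x - v \<bullet> (w - x)) / norm (w - x))"
    using c unfolding le_Liminf_iff zero_ereal_def by (metis ereal_less(2) less_ereal.simps(1) neg_less_0_iff_less zero_ereal_def)
  then obtain d where "d > 0" and d: "\<And>w. w \<noteq> x \<Longrightarrow> dist w x < d \<Longrightarrow>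
      - c < (g w - g x - v \<bullet> (w - x)) / norm (w - x)"
    unfolding eventually_at by auto
  \<comment> \<open>By convexity the difference quotient in the direction of \<open>u\<close> never exceeds \<open>- c\<close>.\<close>
  define s where "s = min 1 (d / (2 * norm (u - x)))"
  have s: "0 < s" "s \<le> 1" using \<open>d > 0\<close> ux by (auto simp: s_def)
  define w where "w = x + s *\<^sub>R (u - x)"
  have wx: "w - x = s *\<^sub>R (u - x)" by (simp add: w_def)
  have w: "w = (1 - s) *\<^sub>R x + s *\<^sub>R u" by (simp add: w_def algebra_simps)
  have "g w \<le> (1 - s) * g x + s * g u"
    unfolding w using convex_onD[OF assms(1), of s x u] s by simp
  moreover have "c * norm (u - x) = g x + v \<bullet> (u - x) - g u"
    using ux by (simp add: c_def)
  ultimately have "g w - g x - v \<bullet> (w - x) \<le> s * (- (c * norm (u - x)))"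
    unfolding wx inner_scaleR_right by (simp only:) (simp add: algebra_simps)
  moreover have "norm (w - x) = s * norm (u - x)" using s by (simp add: wx)
  ultimately have "(g w - g x - v \<bullet> (w - x)) / norm (w - x) \<le> - c"
    using s ux by (simp add: pos_divide_le_eq algebra_simps)
  moreover have "dist w x < d"
  proof -
    have "s * norm (u - x) \<le> d / (2 * norm (u - x)) * norm (u - x)"
      by (intro mult_right_mono) (auto simp: s_def)
    also have "\<dots> < d" using \<open>d > 0\<close> ux by simp
    finally show ?thesis using s by (simp add: dist_norm wx)
  qed
  moreover have "w \<noteq> x" using s ux by (simp add: w_def)
  ultimately show False using d[of w] by simp
qed

lemma limiting_subgradient_convex:
  fixes g :: "'a::euclidean_space \<Rightarrow> real"
  assumes "convex_on UNIV g" and "v \<in> limiting_subdiff g x"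
  shows "g x + v \<bullet> (u - x) \<le> g u"
proof -
  obtain xs vs where lims: "xs \<longlonglongrightarrow> x" "(\<lambda>k. g (xs k)) \<longlonglongrightarrow> g x" "vs \<longlonglongrightarrow> v"
    and sub: "\<And>k. vs k \<in> frechet_subdiff g (xs k)"
    using assms(2) unfolding limiting_subdiff_def by blast
  have "(\<lambda>k. g (xs k) + vs k \<bullet> (u - xs k)) \<longlonglongrightarrow> g x + v \<bullet> (u - x)"
    by (intro tendsto_intros lims)
  then show ?thesis
    by (rule LIMSEQ_le_const2) (use frechet_subgradient_convex[OF assms(1) sub] in blast)
qed

text \<open>Test the inequality along \<open>x + s v\<close> and let \<open>s\<close> tend to \<open>0\<close>, so that the quadratic term
  disappears.\<close>

lemma subgradient_norm_le_lipschitz: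
  fixes F :: "'a::real_inner \<Rightarrow> real"
  assumes lip: "C-lipschitz_on UNIV F"
    and minorant: "\<And>u. F x + v \<bullet> (u - x) - W / 2 * (norm (u - x))\<^sup>2 \<le> F u"
  shows "norm v \<le> C"
proof (cases "v = 0")
  case True
  then show ?thesis using lipschitz_on_nonneg[OF lip] by simp
next
  case False
  have "norm v - s * (W / 2 * norm v) \<le> C" if s: "s > 0" for s
  proof -
    have "F (x + s *\<^sub>R v) - F x \<le> C * (s * norm v)"
      using lipschitz_onD[OF lip, of "x + s *\<^sub>R v" x] s by (simp add: dist_norm)
    moreover have "F x + s * (norm v)\<^sup>2 - W / 2 * (s * norm v)\<^sup>2 \<le> F (x + s *\<^sub>R v)"
      using minorant[of "x + s *\<^sub>R v"] s by (simp add: power2_norm_eq_inner)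
    ultimately have "(s * norm v) * (norm v - s * (W / 2 * norm v)) \<le> (s * norm v) * C"
      by (simp add: power2_eq_square algebra_simps)
    then show ?thesis using s False by simp
  qed
  then have "\<forall>\<^sub>F s in at_right 0. norm v - s * (W / 2 * norm v) \<le> C"
    by (auto simp: eventually_at_right_less eventually_at_filter)
  moreover have "((\<lambda>s. norm v - s * (W / 2 * norm v)) \<longlongrightarrow> norm v - 0 * (W / 2 * norm v)) (at_right 0)"
    by (intro tendsto_intros)
  ultimately show ?thesis
    using tendsto_upperbound by (metis diff_zero mult_zero_left trivial_limit_at_right_real)
qed

lemma set_norm_le:
  assumes "s \<in> S"
  shows "set_norm S \<le> norm s"
  unfolding set_norm_def
  by (rule cINF_lower[OF _ assms]) (auto intro!: bdd_belowI[of _ 0])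

section \<open>Gradients\<close>

lemma gradient_eqI: "GDERIV F x :> D \<Longrightarrow> gradient F x = D"
  unfolding gradient_def
proof (rule the_equality)
  fix D' assume "GDERIV F x :> D" "GDERIV F x :> D'"
  then have "(\<lambda>h. h \<bullet> D) = (\<lambda>h. h \<bullet> D')"
    unfolding gderiv_def by (rule has_derivative_unique)
  then show "D' = D" by (metis inner_commute vector_eq_ldot)
qed

lemma GDERIV_gradient:
  fixes F :: "'a::euclidean_space \<Rightarrow> real"
  assumes "F differentiable at x"
  shows "GDERIV F x :> gradient F x"
proof -
  obtain F' where F': "(F has_derivative F') (at x)"
    using assms unfolding differentiable_def by blast
  have "F' = (\<lambda>h. h \<bullet> adjoint F' 1)"
    using adjoint_works[OF has_derivative_linear[OF F']] by (simp add: fun_eq_iff)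
  then have "GDERIV F x :> adjoint F' 1" using F' by (simp add: gderiv_def)
  then show ?thesis by (simp add: gradient_eqI)
qed

text \<open>The quadratic bound for a function with Lipschitz gradient: along the segment, the
  derivative of the difference between the two sides has constant sign.\<close>

lemma lipschitz_gradient_upper:
  fixes F :: "'a::euclidean_space \<Rightarrow> real"
  assumes diff: "\<And>u. F differentiable at u" and lip: "L-lipschitz_on UNIV (gradient F)"
  shows "F y \<le> F x + gradient F x \<bullet> (y - x) + L / 2 * (norm (y - x))\<^sup>2"
proof -
  define d where "d = y - x"
  define \<phi> where "\<phi> s = F (x + s *\<^sub>R d) - s * (gradient F x \<bullet> d) - L / 2 * s\<^sup>2 * (norm d)\<^sup>2" for s
  have deriv: "(\<phi> has_real_derivative
      gradient F (x + s *\<^sub>R d) \<bullet> d - gradient F x \<bullet> d - L * s * (norm d)\<^sup>2) (at s)" for s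
  proof -
    have "(F has_derivative (\<lambda>h. h \<bullet> gradient F (x + s *\<^sub>R d))) (at (x + s *\<^sub>R d))"
      using GDERIV_gradient[OF diff] by (simp add: gderiv_def)
    moreover have "((\<lambda>s. x + s *\<^sub>R d) has_derivative (\<lambda>h. h *\<^sub>R d)) (at s)"
      by (auto intro!: derivative_eq_intros)
    ultimately have "((\<lambda>s. F (x + s *\<^sub>R d)) has_derivative
        (\<lambda>h. (h *\<^sub>R d) \<bullet> gradient F (x + s *\<^sub>R d))) (at s)"
      by (rule has_derivative_compose[rotated])
    then have "((\<lambda>s. F (x + s *\<^sub>R d)) has_real_derivative gradient F (x + s *\<^sub>R d) \<bullet> d) (at s)"
      unfolding has_field_derivative_def
      by (rule back_subst[where P = "\<lambda>D. (_ has_derivative D) _"]) (auto simp: inner_commute)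
    then show ?thesis
      unfolding \<phi>_def by (auto intro!: derivative_eq_intros)
  qed
  have "\<phi> 1 \<le> \<phi> 0"
  proof (rule DERIV_nonpos_imp_nonincreasing[of 0 1])
    fix s :: real assume s: "0 \<le> s" "s \<le> 1"
    have "norm (gradient F (x + s *\<^sub>R d) - gradient F x) \<le> L * (s * norm d)"
      using lipschitz_onD[OF lip, of "x + s *\<^sub>R d" x] s by (simp add: dist_norm)
    then have "norm (gradient F (x + s *\<^sub>R d) - gradient F x) * norm d \<le> L * (s * norm d) * norm d"
      by (rule mult_right_mono) simp
    then have "(gradient F (x + s *\<^sub>R d) - gradient F x) \<bullet> d \<le> L * (s * norm d) * norm d"
      using norm_cauchy_schwarz order_trans by blast
    then have "gradient F (x + s *\<^sub>R d) \<bullet> d - gradient F x \<bullet> d - L * s * (norm d)\<^sup>2 \<le> 0"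
      by (simp add: inner_diff_left power2_eq_square)
    with deriv show "\<exists>y. (\<phi> has_real_derivative y) (at s) \<and> y \<le> 0" by blast
  qed simp
  then show ?thesis by (simp add: \<phi>_def d_def)
qed

lemma lipschitz_gradient_lower:
  fixes F :: "'a::euclidean_space \<Rightarrow> real"
  assumes diff: "\<And>u. F differentiable at u" and lip: "L-lipschitz_on UNIV (gradient F)"
  shows "F x + gradient F x \<bullet> (y - x) - L / 2 * (norm (y - x))\<^sup>2 \<le> F y"
proof -
  have grad: "gradient (\<lambda>u. - F u) u = - gradient F u" for u
    by (intro gradient_eqI GDERIV_minus GDERIV_gradient diff)
  have "L-lipschitz_on UNIV (gradient (\<lambda>u. - F u))"
    using lip by (simp add: lipschitz_on_def grad dist_minus)
  then show ?thesis
    using lipschitz_gradient_upper[of "\<lambda>u. - F u" L y x] diff by (simp add: grad)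
qed

lemma norm_linear_le_onorm:
  fixes A :: "'a::euclidean_space \<Rightarrow> 'b::euclidean_space"
  assumes "linear A"
  shows "norm (A x) \<le> onorm A * norm x"
  using assms by (intro onorm) (simp add: linear_conv_bounded_linear)

lemma norm_adjoint_le_onorm:
  fixes A :: "'a::euclidean_space \<Rightarrow> 'b::euclidean_space"
  assumes "linear A"
  shows "norm (adjoint A v) \<le> onorm A * norm v"
proof (cases "adjoint A v = 0")
  case True
  then show ?thesis
    using onorm_pos_le[of A] assms by (simp add: linear_conv_bounded_linear)
next
  case False
  have "(norm (adjoint A v))\<^sup>2 = A (adjoint A v) \<bullet> v"
    using adjoint_works[OF assms, of "adjoint A v" v] by (simp add: power2_norm_eq_inner)
  also have "\<dots> \<le> norm (A (adjoint A v)) * norm v" by (rule norm_cauchy_schwarz)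
  also have "\<dots> \<le> onorm A * norm (adjoint A v) * norm v"
    by (intro mult_right_mono norm_linear_le_onorm assms) simp
  finally have "norm (adjoint A v) * norm (adjoint A v) \<le> norm (adjoint A v) * (onorm A * norm v)"
    by (simp add: power2_eq_square mult_ac)
  then show ?thesis using False by simp
qed

lemma GDERIV_penalty_term:
  fixes A :: "'a::euclidean_space \<Rightarrow> 'b::euclidean_space"
  assumes "linear A"
  shows "GDERIV (\<lambda>u. z \<bullet> (A u - c) + \<beta> / 2 * (norm (A u - c))\<^sup>2) x :> adjoint A (z + \<beta> *\<^sub>R (A x - c))"
proof -
  have [derivative_intros]: "(A has_derivative A) (at x)"
    using assms by (simp add: bounded_linear_imp_has_derivative linear_conv_bounded_linear)
  have "((\<lambda>u. z \<bullet> (A u - c) + \<beta> / 2 * ((A u - c) \<bullet> (A u - c))) has_derivative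
      (\<lambda>h. h \<bullet> adjoint A (z + \<beta> *\<^sub>R (A x - c)))) (at x)"
    by (auto intro!: derivative_eq_intros ext
        simp: adjoint_works[OF assms] inner_commute algebra_simps)
  then show ?thesis by (simp add: gderiv_def power2_norm_eq_inner)
qed

lemma gradient_aug_smooth:
  fixes A :: "real ^ 'r ^ 'n \<Rightarrow> real ^ 'm"
  assumes "linear A" and "f differentiable at U"
  shows "gradient (\<lambda>U. aug_smooth f A U y z \<beta>) U
    = gradient f U + adjoint A (z + \<beta> *\<^sub>R (A U - y))"
proof (rule gradient_eqI)
  show "GDERIV (\<lambda>U. aug_smooth f A U y z \<beta>) U
      :> gradient f U + adjoint A (z + \<beta> *\<^sub>R (A U - y))"
    unfolding aug_smooth_def add.assoc
    by (intro GDERIV_add GDERIV_gradient GDERIV_penalty_term assms)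
qed

lemma gradient_aug_smooth_y:
  fixes A :: "real ^ 'r ^ 'n \<Rightarrow> real ^ 'm"
  shows "gradient (\<lambda>u. aug_smooth f A U u z \<beta>) y = - z - \<beta> *\<^sub>R (A U - y)"
proof (rule gradient_eqI)
  have "((\<lambda>u. f U + z \<bullet> (A U - u) + \<beta> / 2 * ((A U - u) \<bullet> (A U - u))) has_derivative
      (\<lambda>h. h \<bullet> (- z - \<beta> *\<^sub>R (A U - y)))) (at y)"
    by (auto intro!: derivative_eq_intros ext simp: inner_commute algebra_simps)
  then show "GDERIV (\<lambda>u. aug_smooth f A U u z \<beta>) y :> - z - \<beta> *\<^sub>R (A U - y)"
    by (simp add: gderiv_def aug_smooth_def power2_norm_eq_inner)
qed

section \<open>Matrices and the Stiefel manifold\<close>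

lemma inner_transpose: "transpose A \<bullet> transpose B = A \<bullet> (B :: real ^ 'n ^ 'm)"
  unfolding inner_vec_def transpose_def by (simp add: sum.swap[of _ "UNIV :: 'n set"])

lemma norm_transpose: "norm (transpose A) = norm (A :: real ^ 'n ^ 'm)"
  by (simp add: norm_eq_sqrt_inner inner_transpose)

lemma inner_matrix_mult_right:
  fixes K :: "real ^ 'm ^ 'n"
  shows "(K ** X) \<bullet> Y = X \<bullet> (transpose K ** Y)"
proof -
  have "(K ** X) \<bullet> Y = (\<Sum>i\<in>UNIV. \<Sum>j\<in>UNIV. \<Sum>k\<in>UNIV. K$i$k * X$k$j * Y$i$j)"
    by (simp add: inner_vec_def matrix_matrix_mult_def sum_distrib_right)
  also have "\<dots> = (\<Sum>i\<in>UNIV. \<Sum>k\<in>UNIV. \<Sum>j\<in>UNIV. K$i$k * X$k$j * Y$i$j)"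
    by (intro sum.cong refl sum.swap)
  also have "\<dots> = (\<Sum>k\<in>UNIV. \<Sum>i\<in>UNIV. \<Sum>j\<in>UNIV. K$i$k * X$k$j * Y$i$j)"
    by (rule sum.swap)
  also have "\<dots> = (\<Sum>k\<in>UNIV. \<Sum>j\<in>UNIV. \<Sum>i\<in>UNIV. K$i$k * X$k$j * Y$i$j)"
    by (intro sum.cong refl sum.swap)
  also have "\<dots> = X \<bullet> (transpose K ** Y)"
    by (simp add: inner_vec_def matrix_matrix_mult_def transpose_def sum_distrib_left mult_ac)
  finally show ?thesis .
qed

lemma inner_matrix_mult_left:
  fixes K :: "real ^ 'm ^ 'n"
  shows "(K ** X) \<bullet> Y = K \<bullet> (Y ** transpose X)"
  using inner_matrix_mult_right[of "transpose X" "transpose K" "transpose Y"]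
  by (metis inner_transpose matrix_transpose_mul transpose_transpose)

lemma power2_norm_vec: "(norm C)\<^sup>2 = (\<Sum>i\<in>UNIV. (norm (C $ i))\<^sup>2)"
  for C :: "'a::real_inner ^ 'b"
  by (simp add: power2_norm_eq_inner inner_vec_def)

lemma norm_matrix_mult_le:
  fixes A :: "real ^ 'm ^ 'n" and B :: "real ^ 'k ^ 'm"
  shows "norm (A ** B) \<le> norm A * norm B"
proof -
  have entry: "(A ** B) $ i $ j = (A $ i) \<bullet> (transpose B $ j)" for i j
    by (simp add: matrix_matrix_mult_def inner_vec_def transpose_def)

  have "(norm (A ** B))\<^sup>2 = (\<Sum>i\<in>UNIV. \<Sum>j\<in>UNIV. ((A $ i) \<bullet> (transpose B $ j))\<^sup>2)"
    by (simp add: power2_norm_vec entry)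
  also have "\<dots> \<le> (\<Sum>i\<in>UNIV. \<Sum>j\<in>UNIV. (norm (A $ i))\<^sup>2 * (norm (transpose B $ j))\<^sup>2)"
    by (intro sum_mono) (metis Cauchy_Schwarz_ineq power2_norm_eq_inner)
  also have "\<dots> = (norm A)\<^sup>2 * (norm (transpose B))\<^sup>2"
    unfolding power2_norm_vec[of A] power2_norm_vec[of "transpose B"] by (simp add: sum_product)
  finally show ?thesis
    by (simp add: norm_transpose flip: power_mult_distrib)
qed

lemma norm_matrix_mult_mono:
  fixes A :: "real ^ 'm ^ 'n" and B :: "real ^ 'k ^ 'm"
  assumes "norm A \<le> a" and "norm B \<le> b"
  shows "norm (A ** B) \<le> a * b"
  using norm_matrix_mult_le[of A B] mult_mono'[OF assms] by simp

interpretation matrix_mult: bounded_bilinear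
  "(**) :: real ^ 'm ^ 'n \<Rightarrow> real ^ 'k ^ 'm \<Rightarrow> real ^ 'k ^ 'n"
proof
  show "(A + A') ** B = A ** B + A' ** B"
    for A A' :: "real ^ 'm ^ 'n" and B :: "real ^ 'k ^ 'm"
    by (simp add: vec_eq_iff matrix_matrix_mult_def sum.distrib distrib_right)
  show "\<exists>K. \<forall>A B. norm ((A :: real ^ 'm ^ 'n) ** (B :: real ^ 'k ^ 'm)) \<le> norm A * norm B * K"
    by (intro exI[of _ 1]) (simp add: norm_matrix_mult_le)
qed (simp_all add: matrix_add_ldistrib scalar_matrix_assoc matrix_scalar_ac)

lemma transpose_add: "transpose (A + B) = transpose A + transpose (B :: real ^ 'n ^ 'm)"
  by (simp add: transpose_def vec_eq_iff)

lemma transpose_diff: "transpose (A - B) = transpose A - transpose (B :: real ^ 'n ^ 'm)"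
  by (simp add: transpose_def vec_eq_iff)

lemma transpose_minus: "transpose (- A) = - transpose (A :: real ^ 'n ^ 'm)"
  by (simp add: transpose_def vec_eq_iff)

lemma inner_skew_mult_eq_0:
  fixes K :: "real ^ 'n ^ 'n"
  assumes "transpose K = - K"
  shows "Y \<bullet> (K ** Y) = 0"
  using inner_matrix_mult_right[of K Y Y] assms
  by (simp add: matrix_mult.minus_left inner_commute)

lemma norm_stiefel:
  fixes X :: "real ^ 'r ^ 'n"
  assumes "X \<in> stiefel"
  shows "norm X = sqrt (real CARD('r))"
proof -
  have "X \<bullet> X = (X ** mat 1) \<bullet> X" by simp
  also have "\<dots> = mat 1 \<bullet> (transpose X ** X)" by (rule inner_matrix_mult_right)
  also have "\<dots> = (mat 1 :: real ^ 'r ^ 'r) \<bullet> mat 1" using assms by (simp add: stiefel_def)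
  also have "\<dots> = real CARD('r)"
    by (simp add: inner_vec_def mat_def if_distrib cong: if_cong)
  finally show ?thesis by (simp add: norm_eq_sqrt_inner)
qed

lemma compact_stiefel: "compact (stiefel :: (real ^ 'r ^ 'n) set)"
  unfolding compact_eq_bounded_closed
proof
  show "bounded (stiefel :: (real ^ 'r ^ 'n) set)"
    by (auto simp: bounded_iff norm_stiefel)
  have "continuous_on UNIV (\<lambda>X :: real ^ 'r ^ 'n. transpose X ** X)"
    unfolding transpose_def
    by (intro matrix_mult.continuous_on continuous_intros)
  then show "closed (stiefel :: (real ^ 'r ^ 'n) set)"
    unfolding stiefel_def by (intro closed_Collect_eq continuous_intros)
qed

text \<open>The Cayley transform: for skew-symmetric \<open>K\<close> the matrix \<open>I + K\<close> is invertible, and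
  \<open>(I + K)\<inverse> (I - K)\<close> is orthogonal. Here it appears through the linear equation that the
  image \<open>Y\<close> of \<open>X\<close> satisfies.\<close>

lemma cayley_exists:
  fixes K :: "real ^ 'n ^ 'n" and X :: "real ^ 'r ^ 'n"
  assumes skew: "transpose K = - K"
  obtains Y where "Y + K ** Y = X - K ** X"
proof -
  define T where "T Y = Y + K ** Y" for Y :: "real ^ 'r ^ 'n"
  have lin: "linear T"
    unfolding T_def by (intro linearI) (simp_all add: matrix_mult.add_right matrix_mult.scaleR_right algebra_simps)
  have "inj T"
    unfolding linear_injective_0[OF lin]
  proof (intro allI impI)
    fix Y assume "T Y = 0"
    then have "Y \<bullet> (Y + K ** Y) = 0" by (simp add: T_def)
    then show "Y = 0" by (simp add: inner_add_right inner_skew_mult_eq_0[OF skew])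
  qed
  then have "surj T" by (rule linear_inj_imp_surj[OF lin])
  then obtain Y where "T Y = X - K ** X" by (metis surjD)
  then show thesis using that by (simp add: T_def)
qed

text \<open>The equation for \<open>Y\<close> makes \<open>(X + Y)\<^sup>T (Y - X)\<close> skew-symmetric, and the symmetric part of
  that product is \<open>Y\<^sup>T Y - X\<^sup>T X\<close>.\<close>

lemma cayley_preserves_stiefel:
  fixes K :: "real ^ 'n ^ 'n" and X :: "real ^ 'r ^ 'n"
  assumes skew: "transpose K = - K" and Y: "Y + K ** Y = X - K ** X" and "X \<in> stiefel"
  shows "Y \<in> stiefel"
proof -
  define M where "M = transpose (X + Y) ** (Y - X)"
  have "Y - X = - (K ** (X + Y))"
    using Y by (simp add: matrix_mult.add_right algebra_simps)
  then have M: "M = - (transpose (X + Y) ** K ** (X + Y))"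
    by (simp add: M_def matrix_mult.minus_right matrix_mul_assoc)
  have "transpose M = - M"
    unfolding M by (simp add: transpose_minus matrix_transpose_mul skew matrix_mul_assoc
        matrix_mult.minus_right matrix_mult.minus_left)
  moreover have "M + transpose M = 2 *\<^sub>R (transpose Y ** Y - transpose X ** X)"
    unfolding M_def
    by (simp add: matrix_transpose_mul transpose_add transpose_diff matrix_mult.add_left
        matrix_mult.diff_right matrix_mult.add_right matrix_mult.diff_left scaleR_2)
  ultimately show ?thesis using assms(3) by (simp add: stiefel_def)
qed

text \<open>\<open>D X\<^sup>T - X D\<^sup>T\<close> generates the rotation of steepest ascent of \<open>\<lambda>Y. Y \<bullet> D\<close> at \<open>X\<close>;
  for \<open>X\<close> on the manifold it vanishes exactly when the tangential part of \<open>D\<close> does.\<close>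

definition rotation_gradient :: "real ^ 'r ^ 'n \<Rightarrow> real ^ 'r ^ 'n \<Rightarrow> real ^ 'n ^ 'n" where
  "rotation_gradient X D = D ** transpose X - X ** transpose D"

lemma transpose_rotation_gradient: "transpose (rotation_gradient X D) = - rotation_gradient X D"
  by (simp add: rotation_gradient_def transpose_diff matrix_transpose_mul)

lemma inner_rotation_gradient:
  "(rotation_gradient X D ** X) \<bullet> D = (norm (rotation_gradient X D))\<^sup>2 / 2"
proof -
  let ?E = "rotation_gradient X D"
  have "?E \<bullet> (X ** transpose D) = transpose ?E \<bullet> transpose (X ** transpose D)"
    by (simp add: inner_transpose)
  also have "\<dots> = - (?E \<bullet> (D ** transpose X))"
    by (simp add: transpose_rotation_gradient matrix_transpose_mul)
  finally have "?E \<bullet> ?E = 2 * (?E \<bullet> (D ** transpose X))"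
    by (subst (2) rotation_gradient_def) (simp add: inner_diff_right)
  then show ?thesis by (simp add: inner_matrix_mult_left power2_norm_eq_inner)
qed

text \<open>With \<open>E\<close> the rotation gradient, the tangential part of \<open>D\<close> is \<open>(I - X X\<^sup>T / 2) E X\<close>.\<close>

lemma norm_proj_tangent_le_rotation_gradient:
  fixes X D :: "real ^ 'r ^ 'n"
  assumes "X \<in> stiefel"
  shows "norm (proj_tangent X D) \<le> 2 * (real CARD('r))\<^sup>2 * norm (rotation_gradient X D)"
proof -
  let ?E = "rotation_gradient X D" and ?r = "real CARD('r)"
  have r: "?r \<ge> 1" using zero_less_card_finite[where 'a='r] by linarith
  have XX: "transpose X ** X = mat 1" using assms by (simp add: stiefel_def)
  have EX: "?E ** X = D - X ** (transpose D ** X)"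
    by (simp add: rotation_gradient_def matrix_mult.diff_left XX flip: matrix_mul_assoc)
  have "proj_tangent X D = ?E ** X - (1/2) *\<^sub>R (X ** (transpose X ** (?E ** X)))"
  proof -
    have "transpose X ** (?E ** X) = transpose X ** D - transpose D ** X"
      unfolding EX by (simp add: matrix_mult.diff_right matrix_mul_assoc XX)
    then show ?thesis
      unfolding EX proj_tangent_def
      by (simp add: matrix_mult.diff_right matrix_mult.add_right algebra_simps)
  qed
  then have "norm (proj_tangent X D)
      \<le> norm (?E ** X) + 1/2 * norm (X ** (transpose X ** (?E ** X)))"
    by (metis (no_types) abs_of_nonneg norm_triangle_ineq4 norm_scaleR zero_le_divide_1_iff zero_le_numeral)
  also have "norm (X ** (transpose X ** (?E ** X))) \<le> norm X * (norm X * norm (?E ** X))"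
    by (intro norm_matrix_mult_mono) (simp_all add: norm_transpose)
  also have "norm (?E ** X) + 1/2 * (norm X * (norm X * norm (?E ** X)))
      = (1 + ?r / 2) * norm (?E ** X)"
    by (simp add: norm_stiefel[OF assms] algebra_simps flip: mult.assoc)
  also have "\<dots> \<le> (2 * ?r) * (?r * norm ?E)"
  proof (intro mult_mono)
    have "norm (?E ** X) \<le> norm ?E * norm X" by (rule norm_matrix_mult_le)
    also have "\<dots> \<le> norm ?E * ?r"
      using r by (intro mult_left_mono) (simp_all add: norm_stiefel[OF assms] real_le_lsqrt power2_eq_square)
    finally show "norm (?E ** X) \<le> ?r * norm ?E" by (simp add: mult.commute)
    show "1 + ?r / 2 \<le> 2 * ?r" using r by linarith
  qed simp_all
  finally show ?thesis by (simp add: power2_eq_square mult_ac)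
qed

lemma norm_proj_tangent_le:
  fixes X D :: "real ^ 'r ^ 'n"
  assumes "X \<in> stiefel"
  shows "norm (proj_tangent X D) \<le> (1 + real CARD('r)) * norm D"
proof -
  have "norm (X ** (transpose D ** X + transpose X ** D))
      \<le> norm X * (norm D * norm X + norm X * norm D)"
    by (intro norm_matrix_mult_mono norm_triangle_mono) (simp_all add: norm_transpose)
  also have "\<dots> = 2 * (norm X)\<^sup>2 * norm D"
    by (simp add: power2_eq_square)
  also have "\<dots> = 2 * real CARD('r) * norm D"
    by (simp add: norm_stiefel[OF assms])
  finally have "norm ((1/2) *\<^sub>R (X ** (transpose D ** X + transpose X ** D))) \<le> real CARD('r) * norm D"
    by simp
  then show ?thesis
    unfolding proj_tangent_def distrib_right
    by (intro order_trans[OF norm_triangle_ineq4]) simp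
qed

lemma proj_tangent_add: "proj_tangent X (D + D') = proj_tangent X D + proj_tangent X D'"
  unfolding proj_tangent_def
  by (simp add: transpose_add matrix_mult.add_right matrix_mult.add_left algebra_simps)

text \<open>A step along the Cayley curve generated by the rotation gradient decreases a quadratic
  model by a multiple of the squared rotation gradient: the first-order term of the curve gives
  half of it times the step length, and the step length \<open>1 / (2 r M)\<close>, with \<open>r\<close> the number of
  columns, is short enough for the second-order terms to take only half of that.\<close>

lemma stiefel_quadratic_decrease:
  fixes X D :: "real ^ 'r ^ 'n"
  assumes X: "X \<in> stiefel" and \<kappa>: "\<kappa> \<ge> 0" and M: "norm D + \<kappa> \<le> M" "M > 0"
  obtains Y where "Y \<in> stiefel"
    and "(Y - X) \<bullet> D + \<kappa> / 2 * (norm (Y - X))\<^sup>2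
      \<le> - (norm (rotation_gradient X D))\<^sup>2 / (8 * real CARD('r) * M)"
proof -
  let ?E = "rotation_gradient X D" and ?r = "real CARD('r)"
  define s where "s = 1 / (2 * ?r * M)"
  define K where "K = (s / 2) *\<^sub>R ?E"
  have r: "?r \<ge> 1" using zero_less_card_finite[where 'a='r] by linarith
  then have s: "s > 0" using M by (simp add: s_def)
  have skew: "transpose K = - K"
    by (simp add: K_def transpose_scalar transpose_rotation_gradient)
  obtain Y where Y: "Y + K ** Y = X - K ** X"
    using cayley_exists[OF skew] .
  have Yst: "Y \<in> stiefel" by (rule cayley_preserves_stiefel[OF skew Y X])
  have diff: "Y - X = - (K ** (X + Y))"
    using Y by (simp add: matrix_mult.add_right algebra_simps)
  have nK: "norm K = s / 2 * norm ?E" using s by (simp add: K_def)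
  have nd: "norm (Y - X) \<le> norm K * (2 * sqrt ?r)"
  proof -
    have "norm (X + Y) \<le> 2 * sqrt ?r"
      using norm_triangle_ineq[of X Y] by (simp add: norm_stiefel X Yst)
    then show ?thesis
      unfolding diff norm_minus_cancel by (intro norm_matrix_mult_mono order_refl)
  qed
  have "Y - X = - (K ** X) - K ** X - K ** (Y - X)"
    unfolding matrix_mult.diff_right using diff
    by (simp add: matrix_mult.add_right algebra_simps)
  then have "(Y - X) \<bullet> D = (- (K ** X) - K ** X - K ** (Y - X)) \<bullet> D"
    by (rule arg_cong)
  then have "(Y - X) \<bullet> D = - (2 * ((K ** X) \<bullet> D)) - (K ** (Y - X)) \<bullet> D"
    by (simp only: inner_diff_left[of _ "K ** (Y - X)"] inner_diff_left[of "- (K ** X)"]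
        inner_minus_left)
  moreover have "2 * ((K ** X) \<bullet> D) = s / 2 * (norm ?E)\<^sup>2"
    by (simp add: K_def matrix_mult.scaleR_left inner_rotation_gradient)
  moreover have "- ((K ** (Y - X)) \<bullet> D) \<le> s\<^sup>2 * (norm ?E)\<^sup>2 * ?r / 2 * norm D"
  proof -
    have "- ((K ** (Y - X)) \<bullet> D) \<le> norm (K ** (Y - X)) * norm D"
      by (metis norm_cauchy_schwarz inner_minus_left norm_minus_cancel)
    also have "\<dots> \<le> (norm K * (norm K * (2 * sqrt ?r))) * norm D"
      by (intro mult_right_mono norm_matrix_mult_mono nd) simp_all
    also have "\<dots> \<le> (norm K * (norm K * (2 * ?r))) * norm D"
      using r by (intro mult_right_mono mult_left_mono) (simp_all add: real_le_lsqrt power2_eq_square)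
    finally show ?thesis by (simp add: nK power2_eq_square algebra_simps)
  qed
  moreover have "\<kappa> / 2 * (norm (Y - X))\<^sup>2 \<le> s\<^sup>2 * (norm ?E)\<^sup>2 * ?r / 2 * \<kappa>"
  proof -
    have "(norm (Y - X))\<^sup>2 \<le> (norm K * (2 * sqrt ?r))\<^sup>2"
      by (intro power_mono nd) simp
    also have "\<dots> = s\<^sup>2 * (norm ?E)\<^sup>2 * ?r"
      by (simp add: nK power_mult_distrib power_divide)
    finally have "\<kappa> / 2 * (norm (Y - X))\<^sup>2 \<le> \<kappa> / 2 * (s\<^sup>2 * (norm ?E)\<^sup>2 * ?r)"
      using \<kappa> by (intro mult_left_mono) auto
    then show ?thesis by (simp add: mult_ac)
  qed
  moreover have "s\<^sup>2 * (norm ?E)\<^sup>2 * ?r / 2 * (norm D + \<kappa>) \<le> s\<^sup>2 * (norm ?E)\<^sup>2 * ?r / 2 * M"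
    using M r by (intro mult_left_mono) auto
  moreover have "s\<^sup>2 * (norm ?E)\<^sup>2 * ?r / 2 * M = s / 4 * (norm ?E)\<^sup>2"
  proof -
    have "s * (?r * M) = 1 / 2" using r M by (simp add: s_def)
    then have "s * (norm ?E)\<^sup>2 / 2 * (s * (?r * M)) = s * (norm ?E)\<^sup>2 / 2 * (1 / 2)"
      by (rule arg_cong)
    moreover have "s\<^sup>2 * (norm ?E)\<^sup>2 * ?r / 2 * M = s * (norm ?E)\<^sup>2 / 2 * (s * (?r * M))"
      by (simp add: power2_eq_square)
    ultimately show ?thesis by linarith
  qed
  ultimately have "(Y - X) \<bullet> D + \<kappa> / 2 * (norm (Y - X))\<^sup>2 \<le> - (s / 4 * (norm ?E)\<^sup>2)"
    unfolding distrib_left by linarith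
  also have "\<dots> = - (norm ?E)\<^sup>2 / (8 * ?r * M)"
    by (simp add: s_def)
  finally show thesis using that Yst by blast
qed

text \<open>A quadratic model that decreases by at most \<open>\<gamma>\<close> on the whole manifold has a small
  projected gradient. This takes the place of the first-order optimality condition of the
  subproblem. It stays valid for \<open>\<kappa> = 0\<close>, where the model does not control the step length.\<close>

lemma norm_proj_tangent_le_decrease:
  fixes X D :: "real ^ 'r ^ 'n"
  assumes X: "X \<in> stiefel" and \<kappa>: "\<kappa> \<ge> 0" and M: "norm D + \<kappa> \<le> M" "M > 0"
    and low: "\<And>Y. Y \<in> stiefel \<Longrightarrow> - \<gamma> \<le> (Y - X) \<bullet> D + \<kappa> / 2 * (norm (Y - X))\<^sup>2"
  shows "(norm (proj_tangent X D))\<^sup>2 \<le> 32 * real CARD('r) ^ 5 * (M * \<gamma>)"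
proof -
  let ?r = "real CARD('r)" and ?e = "norm (rotation_gradient X D)"
  have r: "?r \<ge> 1" using zero_less_card_finite[where 'a='r] by linarith
  obtain Y where "Y \<in> stiefel"
    and "(Y - X) \<bullet> D + \<kappa> / 2 * (norm (Y - X))\<^sup>2 \<le> - ?e\<^sup>2 / (8 * ?r * M)"
    using stiefel_quadratic_decrease[OF X \<kappa> M] .
  with low have "?e\<^sup>2 / (8 * ?r * M) \<le> \<gamma>" by fastforce
  then have e: "?e\<^sup>2 \<le> 8 * ?r * (M * \<gamma>)"
    using r M by (simp add: pos_divide_le_eq mult_ac)
  have "(norm (proj_tangent X D))\<^sup>2 \<le> (2 * ?r\<^sup>2 * ?e)\<^sup>2"
    by (intro power_mono norm_proj_tangent_le_rotation_gradient X) simp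
  also have "\<dots> = 4 * ?r ^ 4 * ?e\<^sup>2" by (simp add: power_mult_distrib)
  also have "\<dots> \<le> 4 * ?r ^ 4 * (8 * ?r * (M * \<gamma>))"
    by (intro mult_left_mono e) simp
  finally show ?thesis by (simp add: eval_nat_numeral mult_ac)
qed

section \<open>The proximal step\<close>

text \<open>A minimiser of a weakly convex function plus a quadratic yields a subgradient inequality
  with the curvature of the weakly convex part only: compare with points on the segment to \<open>v\<close>
  and let them tend to the minimiser.\<close>

lemma prox_subgradient:
  fixes h :: "'a::real_inner \<Rightarrow> real"
  assumes wc: "weakly_convex W h"
    and opt: "is_arg_min (\<lambda>v. h v + k / 2 * (norm (v - b))\<^sup>2) (\<lambda>v. True) x"
  shows "h x + (k *\<^sub>R (b - x)) \<bullet> (v - x) - W / 2 * (norm (v - x))\<^sup>2 \<le> h v"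
proof -
  define u where "u = v - x"
  have ineq: "h x + k * ((b - x) \<bullet> u) - W / 2 * (1 - s) * (u \<bullet> u) - k / 2 * s * (u \<bullet> u) \<le> h v"
    if s: "0 < s" "s < 1" for s :: real
  proof -
    have "(1 - s) *\<^sub>R x + s *\<^sub>R v = x + s *\<^sub>R u" by (simp add: u_def algebra_simps)
    with convex_onD[OF wc[unfolded weakly_convex_def], of s x v] s
    have "h (x + s *\<^sub>R u) + W / 2 * (norm (x + s *\<^sub>R u))\<^sup>2
        \<le> (1 - s) * (h x + W / 2 * (norm x)\<^sup>2) + s * (h v + W / 2 * (norm v)\<^sup>2)"
      by simp
    also have "\<dots> = (1 - s) * h x + s * h v + W / 2 * ((1 - s) * (norm x)\<^sup>2 + s * (norm v)\<^sup>2)"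
      by (simp add: algebra_simps add_divide_distrib diff_divide_distrib)
    also have "(1 - s) * (norm x)\<^sup>2 + s * (norm v)\<^sup>2 = s * (1 - s) * (u \<bullet> u) + (norm (x + s *\<^sub>R u))\<^sup>2"
      by (simp add: u_def power2_norm_eq_inner inner_commute algebra_simps)
    finally have "h (x + s *\<^sub>R u) \<le> (1 - s) * h x + s * h v + W / 2 * (s * (1 - s) * (u \<bullet> u))"
      by (simp only: distrib_left)
    moreover have "h x + k / 2 * (norm (x - b))\<^sup>2 \<le> h (x + s *\<^sub>R u) + k / 2 * (norm (x + s *\<^sub>R u - b))\<^sup>2"
      using opt by (simp add: is_arg_min_linorder)
    moreover have "k / 2 * (norm (x + s *\<^sub>R u - b))\<^sup>2
        = k / 2 * (norm (x - b))\<^sup>2 - s * (k * ((b - x) \<bullet> u)) + s * (k / 2 * s * (u \<bullet> u))"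
      unfolding power2_norm_eq_inner
      by (simp add: inner_commute algebra_simps)
    moreover have "(1 - s) * h x = h x - s * h x" by (simp add: algebra_simps)
    ultimately have "s * h x + s * (k * ((b - x) \<bullet> u)) - W / 2 * (s * (1 - s) * (u \<bullet> u))
        - s * (k / 2 * s * (u \<bullet> u)) \<le> s * h v"
      by linarith
    then have "s * (h x + k * ((b - x) \<bullet> u) - W / 2 * (1 - s) * (u \<bullet> u) - k / 2 * s * (u \<bullet> u)) \<le> s * h v"
      by (simp add: right_diff_distrib distrib_left mult_ac diff_divide_distrib)
    then show ?thesis using s by simp
  qed
  let ?q = "\<lambda>s. h x + k * ((b - x) \<bullet> u) - W / 2 * (1 - s) * (u \<bullet> u) - k / 2 * s * (u \<bullet> u)"
  have "(?q \<longlongrightarrow> ?q 0) (at_right 0)" by (intro tendsto_intros)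
  moreover have "\<forall>\<^sub>F s in at_right 0. ?q s \<le> h v"
    unfolding eventually_at_right_field using ineq by (intro exI[of _ 1]) auto
  ultimately have "?q 0 \<le> h v"
    by (intro tendsto_upperbound) auto
  then show ?thesis by (simp add: u_def power2_norm_eq_inner)
qed

text \<open>Joint strong convexity of \<open>(v, u) \<mapsto> h v + |v - u|\<^sup>2 / (2 \<mu>) + \<beta> |u - b|\<^sup>2 / 2\<close> in the
  second variable, around its stationary point: minimising over \<open>v\<close> costs at most \<open>W |u - y|\<^sup>2\<close>
  as long as \<open>2 W \<mu> \<le> 1\<close>.\<close>

lemma prox_joint_growth:
  fixes h :: "'a::real_inner \<Rightarrow> real"
  assumes sub: "\<And>v. h x + w \<bullet> (v - x) - W / 2 * (norm (v - x))\<^sup>2 \<le> h v"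
    and x: "x = y - \<mu> *\<^sub>R w" and w: "w = \<beta> *\<^sub>R (b - y)"
    and \<mu>: "\<mu> > 0" and W: "W \<ge> 0" "2 * W * \<mu> \<le> 1"
  shows "h x + 1 / (2 * \<mu>) * (norm (x - y))\<^sup>2 + \<beta> / 2 * (norm (y - b))\<^sup>2
      + (\<beta> - 2 * W) / 2 * (norm (u - y))\<^sup>2
    \<le> h v + 1 / (2 * \<mu>) * (norm (v - u))\<^sup>2 + \<beta> / 2 * (norm (u - b))\<^sup>2"
proof -
  define p q where "p = v - x" and "q = u - y"
  have "v - u = - (\<mu> *\<^sub>R w) + (p - q)" by (simp add: p_def q_def x)
  then have "(norm (v - u))\<^sup>2 = (norm (- (\<mu> *\<^sub>R w) + (p - q)))\<^sup>2" by simp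
  also have "\<dots> = (norm (x - y))\<^sup>2 - 2 * \<mu> * (w \<bullet> (p - q)) + (norm (p - q))\<^sup>2"
    unfolding power2_norm_eq_inner x by (simp add: inner_commute algebra_simps)
  finally have "1 / (2 * \<mu>) * (norm (v - u))\<^sup>2
      = 1 / (2 * \<mu>) * (norm (x - y))\<^sup>2 - w \<bullet> (p - q) + 1 / (2 * \<mu>) * (norm (p - q))\<^sup>2"
    using \<mu> by (simp add: field_simps)
  moreover have "\<beta> / 2 * (norm (u - b))\<^sup>2
      = \<beta> / 2 * (norm (y - b))\<^sup>2 - w \<bullet> q + \<beta> / 2 * (norm q)\<^sup>2"
    unfolding power2_norm_eq_inner w q_def by (simp add: inner_commute algebra_simps)
  moreover have "h x + w \<bullet> p - W / 2 * (norm p)\<^sup>2 \<le> h v"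
    using sub[of v] by (simp add: p_def)
  moreover have "W / 2 * (norm p)\<^sup>2 \<le> 1 / (2 * \<mu>) * (norm (p - q))\<^sup>2 + W * (norm q)\<^sup>2"
  proof -
    have "(norm p)\<^sup>2 \<le> 2 * (norm (p - q))\<^sup>2 + 2 * (norm q)\<^sup>2"
      using zero_le_power2[of "norm (p - q - q)"] unfolding power2_norm_eq_inner
      by (simp add: inner_commute algebra_simps)
    then have "W / 2 * (norm p)\<^sup>2 \<le> W / 2 * (2 * (norm (p - q))\<^sup>2 + 2 * (norm q)\<^sup>2)"
      using W by (intro mult_left_mono) auto
    moreover have "W * (norm (p - q))\<^sup>2 \<le> 1 / (2 * \<mu>) * (norm (p - q))\<^sup>2"
      using W \<mu> by (intro mult_right_mono) (auto simp: field_simps)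
    ultimately show ?thesis by (simp add: algebra_simps)
  qed
  moreover have "w \<bullet> (p - q) = w \<bullet> p - w \<bullet> q" by (rule inner_diff_right)
  moreover have "(\<beta> - 2 * W) / 2 * (norm (u - y))\<^sup>2 = \<beta> / 2 * (norm q)\<^sup>2 - W * (norm q)\<^sup>2"
    by (simp add: q_def field_simps)
  ultimately show ?thesis by linarith
qed

text \<open>Hence minimising the Moreau envelope plus a quadratic has the closed form through the
  proximal point of \<open>h\<close> itself.\<close>

lemma moreau_env_minimizer_eq:
  fixes h :: "'a::real_inner \<Rightarrow> real"
  assumes sub: "\<And>v. h x + w \<bullet> (v - x) - W / 2 * (norm (v - x))\<^sup>2 \<le> h v"
    and x: "x = y - \<mu> *\<^sub>R w" and w: "w = \<beta> *\<^sub>R (b - y)"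
    and \<mu>: "\<mu> > 0" and W: "W \<ge> 0" "2 * W * \<mu> \<le> 1" "2 * W < \<beta>"
    and opt: "is_arg_min (\<lambda>u. moreau_env \<mu> h u + \<beta> / 2 * (norm (u - b))\<^sup>2) (\<lambda>u. True) y'"
  shows "y' = y"
proof -
  define J where "J = h x + 1 / (2 * \<mu>) * (norm (x - y))\<^sup>2 + \<beta> / 2 * (norm (y - b))\<^sup>2"
  have growth: "J + (\<beta> - 2 * W) / 2 * (norm (u - y))\<^sup>2 - \<beta> / 2 * (norm (u - b))\<^sup>2
      \<le> h v + 1 / (2 * \<mu>) * (norm (v - u))\<^sup>2" for u v
    using prox_joint_growth[OF sub x w \<mu> W(1,2), of u v] by (simp add: J_def)
  have "J + (\<beta> - 2 * W) / 2 * (norm (y' - y))\<^sup>2 - \<beta> / 2 * (norm (y' - b))\<^sup>2 \<le> moreau_env \<mu> h y'"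
    unfolding moreau_env_def by (rule cINF_greatest) (use growth in auto)
  moreover have "moreau_env \<mu> h y \<le> h x + 1 / (2 * \<mu>) * (norm (x - y))\<^sup>2"
    unfolding moreau_env_def
    by (rule cINF_lower) (use growth in \<open>auto intro!: bdd_belowI2\<close>)
  moreover have "moreau_env \<mu> h y' + \<beta> / 2 * (norm (y' - b))\<^sup>2
      \<le> moreau_env \<mu> h y + \<beta> / 2 * (norm (y - b))\<^sup>2"
    using opt by (simp add: is_arg_min_linorder)
  ultimately have "(\<beta> - 2 * W) / 2 * (norm (y' - y))\<^sup>2 \<le> 0"
    unfolding J_def by linarith
  then show "y' = y" using W by (simp add: mult_le_0_iff)
qed

text \<open>The multiplier \<open>w\<close> is the gradient of the Moreau envelope at \<open>y\<close>. This is its Lipschitz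
  continuity, for two different smoothing parameters: weak monotonicity of the subgradients of
  \<open>h\<close> is turned into a bound by the relation between \<open>x\<close> and \<open>y\<close>.\<close>

lemma prox_multiplier_lipschitz:
  fixes h :: "'a::real_inner \<Rightarrow> real"
  assumes sub: "\<And>v. h x + w \<bullet> (v - x) - W / 2 * (norm (v - x))\<^sup>2 \<le> h v"
    and sub': "\<And>v. h x' + w' \<bullet> (v - x') - W / 2 * (norm (v - x'))\<^sup>2 \<le> h v"
    and x: "x = y - \<mu> *\<^sub>R w" and x': "x' = y' - \<mu>' *\<^sub>R w'"
    and \<mu>: "\<mu> > 0" and W: "W \<ge> 0" "2 * W * \<mu> \<le> 1"
  shows "\<mu> * norm (w - w') \<le> norm ((y - y') - (\<mu> - \<mu>') *\<^sub>R w')"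
proof -
  define e q where "e = (y - y') - (\<mu> - \<mu>') *\<^sub>R w'" and "q = \<mu> *\<^sub>R (w - w')"
  have xx: "x - x' = e - q"
    by (simp add: e_def q_def x x' algebra_simps)
  have "w \<bullet> (x' - x) = - (w \<bullet> (x - x'))" by (metis inner_minus_right minus_diff_eq)
  then have "- (W * (norm (x - x'))\<^sup>2) \<le> (w - w') \<bullet> (x - x')"
    using sub[of x'] sub'[of x] by (simp add: norm_minus_commute inner_diff_left)
  then have "\<mu> * - (W * (norm (x - x'))\<^sup>2) \<le> \<mu> * ((w - w') \<bullet> (x - x'))"
    using \<mu> by (intro mult_left_mono) auto
  then have "- (\<mu> * W * (norm (e - q))\<^sup>2) \<le> q \<bullet> (e - q)"
    by (simp add: xx q_def mult.assoc)
  moreover have "\<mu> * W * (norm (e - q))\<^sup>2 \<le> 1 / 2 * (norm (e - q))\<^sup>2"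
    using W by (intro mult_right_mono) (auto simp: mult_ac)
  ultimately have "0 \<le> 2 * (q \<bullet> (e - q)) + (norm (e - q))\<^sup>2" by linarith
  also have "\<dots> = (norm e)\<^sup>2 - (norm q)\<^sup>2"
    unfolding power2_norm_eq_inner by (simp add: inner_commute algebra_simps)
  finally have "(norm q)\<^sup>2 \<le> (norm e)\<^sup>2" by linarith
  then have "norm q \<le> norm e" by (rule power2_le_imp_le) simp
  then show ?thesis using \<mu> by (simp add: q_def e_def)
qed

section \<open>Estimates for powers\<close>

text \<open>Bernoulli's inequality in the form \<open>(1 + 1 / t) powr p \<le> 1 + 1 / t\<close>.\<close>

lemma powr_Suc_le:
  assumes "0 < p" "p < 1"
  shows "real (Suc t) powr p \<le> real t powr p + 1"
proof (cases "t = 0")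
  case False
  then have t: "real t > 0" by simp
  have "real (Suc t) = real t * (1 + 1 / real t)" using t by (simp add: field_simps)
  then have "real (Suc t) powr p = real t powr p * (1 + 1 / real t) powr p"
    by (simp add: powr_mult del: of_nat_Suc)
  also have "\<dots> \<le> real t powr p * (1 + 1 / real t)"
    using powr_mono[of p 1 "1 + 1 / real t"] assms t by (intro mult_left_mono) auto
  also have "\<dots> = real t powr p + real t powr (p - 1)"
    using t by (simp add: powr_diff field_simps)
  also have "real t powr (p - 1) \<le> 1"
    using powr_mono[of "p - 1" 0 "real t"] assms False by simp
  finally show ?thesis by simp
qed (use assms in simp)

text \<open>With \<open>a\<close> and \<open>b\<close> the cube roots of \<open>T + 1\<close> and \<open>T\<close>, the step of the induction is the
  factorisation of \<open>a ^ 3 - b ^ 3 = 1\<close>.\<close>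

lemma sum_powr_neg_third_le: "(\<Sum>t=1..T. real t powr (-1/3)) \<le> 2 * real T powr (2/3)"
proof (induction T)
  case (Suc T)
  define a b where "a = real (Suc T) powr (1/3)" and "b = real T powr (1/3)"
  have ab: "0 < a" "0 \<le> b" "b \<le> a" by (auto simp: a_def b_def intro: powr_mono2)
  have cube: "real (Suc T) = a ^ 3" "real T = b ^ 3"
    by (cases "T = 0"; simp add: a_def b_def powr_power)+
  have sq: "real (Suc T) powr (2/3) = a\<^sup>2" "real T powr (2/3) = b\<^sup>2"
    by (cases "T = 0"; simp add: a_def b_def powr_power)+
  have inv: "real (Suc T) powr (-1/3) = 1 / a"
    by (simp add: a_def powr_minus_divide)
  have "(a - b) * (a\<^sup>2 + a * b + b\<^sup>2) = 1"
    using cube by (simp add: power2_eq_square power3_eq_cube algebra_simps)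
  moreover have "(a - b) * (a\<^sup>2 + a * b + b\<^sup>2) \<le> (a - b) * (2 * (a + b) * a)"
  proof (intro mult_left_mono)
    have "b\<^sup>2 \<le> a\<^sup>2" "0 \<le> a * b" using ab by (simp_all add: power_mono)
    then show "a\<^sup>2 + a * b + b\<^sup>2 \<le> 2 * (a + b) * a"
      by (simp add: power2_eq_square algebra_simps)
  qed (use ab in simp)
  ultimately have "1 \<le> 2 * (a\<^sup>2 - b\<^sup>2) * a"
    by (simp add: power2_eq_square algebra_simps)
  then have "1 / a \<le> 2 * (a\<^sup>2 - b\<^sup>2)"
    using ab by (subst pos_divide_le_eq) simp_all
  with Suc.IH have "(\<Sum>t=1..T. real t powr (-1/3)) + real (Suc T) powr (-1/3) \<le> 2 * b\<^sup>2 + 2 * (a\<^sup>2 - b\<^sup>2)"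
    unfolding sq inv by (rule add_mono)
  also have "\<dots> = 2 * a\<^sup>2" by simp
  finally show ?case
    unfolding sq by (simp del: of_nat_Suc)
qed simp

section \<open>The run, its penalties and its multipliers\<close>

locale oadmm_run =
  fixes f g :: "real ^ 'r ^ 'n \<Rightarrow> real"
    and h :: "real ^ 'm \<Rightarrow> real"
    and A :: "real ^ 'r ^ 'n \<Rightarrow> real ^ 'm"
    and Lf Cf Cg Ch Wh p \<xi> \<theta> \<sigma> \<tau> \<beta>0 \<alpha> :: real
    and X :: "nat \<Rightarrow> real ^ 'r ^ 'n"
    and y yb z :: "nat \<Rightarrow> real ^ 'm"
  assumes lin: "linear A"
    and f_diff: "\<And>U. f differentiable (at U)"
    and f_lip: "Lf-lipschitz_on UNIV (gradient f)"
    and f_grad: "\<And>U. U \<in> stiefel \<Longrightarrow> norm (gradient f U) \<le> Cf"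
    and g_convex: "convex_on UNIV g"
    and g_lip: "Cg-lipschitz_on UNIV g"
    and h_lip: "Ch-lipschitz_on UNIV h"
    and Wh: "Wh \<ge> 0"
    and h_wc: "weakly_convex Wh h"
    and p: "0 < p" "p < 1"
    and \<xi>: "0 < \<xi>" "\<xi> < 1"
    and \<theta>: "\<theta> > 1"
    and \<sigma>: "1 \<le> \<sigma>" "\<sigma> < 2"
    and \<tau>: "\<tau> \<ge> 4 / (2 - \<sigma>)"
    and \<beta>0: "\<beta>0 > 0" "\<beta>0 \<ge> 2 * \<tau> * Wh"
    and \<alpha>: "0 \<le> \<alpha>" "\<alpha> < (\<theta> - 1) / ((\<theta> + 1) * (\<xi> + 2))"
    and run: "oadmm_ep f g h A Lf p \<xi> \<theta> \<sigma> \<tau> \<beta>0 \<alpha> X y yb z"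
begin

abbreviation \<beta> :: "nat \<Rightarrow> real" where "\<beta> \<equiv> penalty \<beta>0 \<xi> p"

definition L :: "nat \<Rightarrow> real" where "L t = \<beta> t * (onorm A)\<^sup>2 + Lf"

definition Xc :: "nat \<Rightarrow> real ^ 'r ^ 'n" where "Xc t = X t + \<alpha> *\<^sub>R (X t - X (t - 1))"

text \<open>The value of the multiplier after a full dual step; \<open>z\<close> moves towards it with
  relaxation \<open>\<sigma>\<close>.\<close>

definition w :: "nat \<Rightarrow> real ^ 'm" where
  "w t = z (t - 1) + \<beta> (t - 1) *\<^sub>R (A (X t) - y t)"

lemma \<tau>_ge_4: "\<tau> \<ge> 4"
proof -
  have "4 \<le> 4 / (2 - \<sigma>)" using \<sigma> by (simp add: pos_le_divide_eq)
  with \<tau> show ?thesis by linarith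
qed

lemma \<alpha>_less_1: "\<alpha> < 1"
proof -
  have "(\<theta> - 1) / ((\<theta> + 1) * (\<xi> + 2)) \<le> 1"
  proof (subst pos_divide_le_eq)
    show "0 < (\<theta> + 1) * (\<xi> + 2)" using \<theta> \<xi> by simp
    have "\<theta> + 1 \<le> (\<theta> + 1) * (\<xi> + 2)" using \<theta> \<xi> by (simp add: algebra_simps)
    then show "\<theta> - 1 \<le> 1 * ((\<theta> + 1) * (\<xi> + 2))" by linarith
  qed
  with \<alpha> show ?thesis by linarith
qed

lemma Lf_nonneg: "Lf \<ge> 0" using lipschitz_on_nonneg[OF f_lip] .

lemma Ch_nonneg: "Ch \<ge> 0" using lipschitz_on_nonneg[OF h_lip] .

lemma onorm_nonneg: "onorm A \<ge> 0"
  using lin by (intro onorm_pos_le) (simp add: linear_conv_bounded_linear)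

lemma penalty_ge: "\<beta>0 \<le> \<beta> t"
  using \<beta>0 \<xi> by (simp add: penalty_def)

lemma penalty_pos: "0 < \<beta> t"
  using penalty_ge[of t] \<beta>0 by linarith

lemma penalty_mono: "\<beta> t \<le> \<beta> (Suc t)"
  unfolding penalty_def using \<beta>0 \<xi> p by (intro mult_left_mono add_mono powr_mono2) auto

lemma penalty_step_le: "\<beta> (Suc t) - \<beta> t \<le> \<xi> * \<beta>0"
proof -
  have "\<xi> * real (Suc t) powr p \<le> \<xi> * (real t powr p + 1)"
    using powr_Suc_le[OF p] \<xi> by (intro mult_left_mono) auto
  then have "\<beta>0 * (\<xi> * real (Suc t) powr p) \<le> \<beta>0 * (\<xi> * (real t powr p + 1))"
    by (rule mult_left_mono) (use \<beta>0 in simp)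
  then show ?thesis by (simp add: penalty_def algebra_simps)
qed

lemma penalty_ratio_le: "\<beta> (Suc t) \<le> (1 + \<xi>) * \<beta> t"
proof -
  have "\<xi> * \<beta>0 \<le> \<xi> * \<beta> t" using penalty_ge \<xi> by (intro mult_left_mono) auto
  then show ?thesis using penalty_step_le[of t] by (simp add: algebra_simps)
qed

lemma penalty_double: "\<beta> (Suc t) \<le> 2 * \<beta> t"
proof -
  have "(1 + \<xi>) * \<beta> t \<le> 2 * \<beta> t"
    using \<xi> penalty_pos[of t] by (intro mult_right_mono) auto
  then show ?thesis using penalty_ratio_le[of t] by linarith
qed

lemma L_nonneg: "0 \<le> L t"
  unfolding L_def using Lf_nonneg penalty_pos[of t] by simp

lemma L_ratio_le: "L (Suc t) \<le> (1 + \<xi>) * L t"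
proof -
  have "\<beta> (Suc t) * (onorm A)\<^sup>2 \<le> (1 + \<xi>) * \<beta> t * (onorm A)\<^sup>2"
    by (intro mult_right_mono penalty_ratio_le) simp
  moreover have "Lf \<le> (1 + \<xi>) * Lf" using Lf_nonneg \<xi> by (simp add: algebra_simps)
  ultimately show ?thesis by (simp add: L_def algebra_simps)
qed

text \<open>The smoothing parameter never exceeds half the inverse weak convexity of \<open>h\<close>, which is what
  makes the Moreau envelope smooth.\<close>

lemma weak_convexity_small: "2 * Wh * (\<tau> / \<beta> t) \<le> 1" "2 * Wh \<le> \<beta> t / 4"
proof -
  have b: "2 * \<tau> * Wh \<le> \<beta> t" using penalty_ge[of t] \<beta>0 by linarith
  then show "2 * Wh * (\<tau> / \<beta> t) \<le> 1" using penalty_pos[of t] by (simp add: field_simps)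
  have "4 * Wh \<le> \<tau> * Wh" using \<tau>_ge_4 Wh by (intro mult_right_mono) auto
  then show "2 * Wh \<le> \<beta> t / 4" using b by linarith
qed

text \<open>The iteration with the gradient in \<open>y\<close> evaluated: the centre of the proximal step is
  \<open>A X + z / \<beta>\<close>.\<close>

lemma run_step:
  shows "\<exists>v \<in> limiting_subdiff g (X t). is_arg_min
      (\<lambda>U. (U - X t) \<bullet> (gradient (\<lambda>U. aug_smooth f A U (y t) (z t) (\<beta> t)) (Xc t) - v)
        + \<theta> * L t / 2 * (norm (U - Xc t))\<^sup>2) (\<lambda>U. U \<in> stiefel) (X (Suc t))"
    and "is_arg_min (\<lambda>u. moreau_env (\<tau> / \<beta> t) h u
        + \<beta> t / 2 * (norm (u - (A (X (Suc t)) + (1 / \<beta> t) *\<^sub>R z t)))\<^sup>2) (\<lambda>u. True) (y (Suc t))"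
    and "is_arg_min (\<lambda>v. h v + 1 / (2 * (\<tau> / \<beta> t + 1 / \<beta> t))
        * (norm (v - (A (X (Suc t)) + (1 / \<beta> t) *\<^sub>R z t)))\<^sup>2) (\<lambda>v. True) (yb (Suc t))"
    and "z (Suc t) = z t + (\<sigma> * \<beta> t) *\<^sub>R (A (X (Suc t)) - y (Suc t))"
proof -
  have b: "y t - (1 / \<beta> t) *\<^sub>R gradient (\<lambda>u. aug_smooth f A (X (t + 1)) u (z t) (\<beta> t)) (y t)
      = A (X (Suc t)) + (1 / \<beta> t) *\<^sub>R z t"
    using penalty_pos[of t] by (simp add: gradient_aug_smooth_y algebra_simps)
  note step = run[unfolded oadmm_ep_def, THEN conjunct2, rule_format, of t, unfolded Let_def b]
  show "\<exists>v \<in> limiting_subdiff g (X t). is_arg_min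
      (\<lambda>U. (U - X t) \<bullet> (gradient (\<lambda>U. aug_smooth f A U (y t) (z t) (\<beta> t)) (Xc t) - v)
        + \<theta> * L t / 2 * (norm (U - Xc t))\<^sup>2) (\<lambda>U. U \<in> stiefel) (X (Suc t))"
    using step unfolding Xc_def L_def by simp
  show "is_arg_min (\<lambda>u. moreau_env (\<tau> / \<beta> t) h u
        + \<beta> t / 2 * (norm (u - (A (X (Suc t)) + (1 / \<beta> t) *\<^sub>R z t)))\<^sup>2) (\<lambda>u. True) (y (Suc t))"
    using step by simp
  show "is_arg_min (\<lambda>v. h v + 1 / (2 * (\<tau> / \<beta> t + 1 / \<beta> t))
        * (norm (v - (A (X (Suc t)) + (1 / \<beta> t) *\<^sub>R z t)))\<^sup>2) (\<lambda>v. True) (yb (Suc t))"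
    using step by simp
  show "z (Suc t) = z t + (\<sigma> * \<beta> t) *\<^sub>R (A (X (Suc t)) - y (Suc t))"
    using step by simp
qed

lemma multiplier_conv_prox_center:
  "w (Suc t) = \<beta> t *\<^sub>R (A (X (Suc t)) + (1 / \<beta> t) *\<^sub>R z t - y (Suc t))"
  using penalty_pos[of t] by (simp add: w_def algebra_simps)

text \<open>The optimality of \<open>yb\<close> makes a multiple of \<open>b - yb\<close> a subgradient. The closed form of the
  Moreau minimiser identifies that multiple with \<open>w\<close>.\<close>

lemma
  shows multiplier_subgradient: "h (yb (Suc t)) + w (Suc t) \<bullet> (v - yb (Suc t))
      - Wh / 2 * (norm (v - yb (Suc t)))\<^sup>2 \<le> h v"
    and yb_eq: "yb (Suc t) = y (Suc t) - (\<tau> / \<beta> t) *\<^sub>R w (Suc t)"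
proof -
  define b where "b = A (X (Suc t)) + (1 / \<beta> t) *\<^sub>R z t"
  define k where "k = \<beta> t / (1 + \<tau>)"
  define w' where "w' = k *\<^sub>R (b - yb (Suc t))"
  define y' where "y' = b - (1 / \<beta> t) *\<^sub>R w'"
  have \<tau>': "1 + \<tau> > 0" using \<tau>_ge_4 by simp
  have bp: "\<beta> t > 0" by (rule penalty_pos)
  have k: "1 / (2 * (\<tau> / \<beta> t + 1 / \<beta> t)) = k / 2" "(1 + \<tau>) / \<beta> t * k = 1"
    using bp \<tau>' by (simp_all add: k_def add.commute flip: add_divide_distrib)
  have sub: "h (yb (Suc t)) + w' \<bullet> (v - yb (Suc t)) - Wh / 2 * (norm (v - yb (Suc t)))\<^sup>2 \<le> h v" for v
    unfolding w'_def
    using run_step(3)[of t] unfolding k(1) b_def[symmetric] by (rule prox_subgradient[OF h_wc])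
  have "yb (Suc t) = b - ((1 + \<tau>) / \<beta> t) *\<^sub>R w'"
    unfolding w'_def scaleR_scaleR k(2) by simp
  also have "\<dots> = y' - (\<tau> / \<beta> t) *\<^sub>R w'"
    by (simp add: y'_def add_divide_distrib scaleR_add_left)
  finally have yb: "yb (Suc t) = y' - (\<tau> / \<beta> t) *\<^sub>R w'" .
  have w': "w' = \<beta> t *\<^sub>R (b - y')" using bp by (simp add: y'_def)
  have "2 * Wh < \<beta> t" using weak_convexity_small(2)[of t] bp by linarith
  then have "y (Suc t) = y'"
    using run_step(2)[of t] bp \<tau>_ge_4 Wh weak_convexity_small(1)
    by (intro moreau_env_minimizer_eq[OF sub yb w']) (auto simp: b_def)
  moreover have "w (Suc t) = w'"
    unfolding multiplier_conv_prox_center w' b_def[symmetric] calculation ..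
  ultimately show "h (yb (Suc t)) + w (Suc t) \<bullet> (v - yb (Suc t))
      - Wh / 2 * (norm (v - yb (Suc t)))\<^sup>2 \<le> h v"
    and "yb (Suc t) = y (Suc t) - (\<tau> / \<beta> t) *\<^sub>R w (Suc t)"
    using sub yb by auto
qed

lemma norm_multiplier_le: "norm (w (Suc t)) \<le> Ch"
  using multiplier_subgradient by (rule subgradient_norm_le_lipschitz[OF h_lip])

lemma dual_step: "z (Suc t) = z t + \<sigma> *\<^sub>R (w (Suc t) - z t)"
  unfolding run_step(4) w_def by simp

text \<open>A bound on \<open>z\<close>: the second entry is the fixed point of the recursion
  \<open>c \<mapsto> \<sigma> Ch + (\<sigma> - 1) c\<close> that the norms obey.\<close>

definition Z :: real where "Z = max (norm (z 0)) (\<sigma> * Ch / (2 - \<sigma>))"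

lemma norm_dual_le: "norm (z t) \<le> Z"
proof (induction t)
  case (Suc t)
  have "z (Suc t) = \<sigma> *\<^sub>R w (Suc t) - (\<sigma> - 1) *\<^sub>R z t"
    unfolding dual_step by (simp add: algebra_simps)
  then have "norm (z (Suc t)) \<le> \<sigma> * norm (w (Suc t)) + (\<sigma> - 1) * norm (z t)"
    using norm_triangle_ineq4[of "\<sigma> *\<^sub>R w (Suc t)" "(\<sigma> - 1) *\<^sub>R z t"] \<sigma> by simp
  also have "\<dots> \<le> \<sigma> * Ch + (\<sigma> - 1) * Z"
    using \<sigma> norm_multiplier_le Suc.IH by (intro add_mono mult_left_mono) auto
  also have "\<sigma> * Ch \<le> (2 - \<sigma>) * Z"
  proof -
    have "\<sigma> * Ch / (2 - \<sigma>) \<le> Z" by (simp add: Z_def)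
    then show ?thesis using \<sigma> by (simp add: pos_divide_le_eq mult.commute)
  qed
  finally show ?case by (simp add: algebra_simps)
qed (simp add: Z_def)

lemma Z_nonneg: "0 \<le> Z" using norm_dual_le[of 0] norm_ge_zero order_trans by blast

lemma norm_dual_diff_le: "norm (z (Suc t) - z t) \<le> 2 * Z"
  using norm_triangle_ineq4[of "z (Suc t)" "z t"] norm_dual_le[of t] norm_dual_le[of "Suc t"] by linarith

lemma residual_eq: "\<sigma> * (\<beta> t * norm (A (X (Suc t)) - y (Suc t))) = norm (z (Suc t) - z t)"
  unfolding run_step(4) using \<sigma> penalty_pos[of t] by simp

lemma residual_le_dual_diff: "\<beta> t * norm (A (X (Suc t)) - y (Suc t)) \<le> norm (z (Suc t) - z t)"
proof -
  have "1 * (\<beta> t * norm (A (X (Suc t)) - y (Suc t))) \<le> \<sigma> * (\<beta> t * norm (A (X (Suc t)) - y (Suc t)))"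
    using \<sigma> penalty_pos[of t] by (intro mult_right_mono) auto
  then show ?thesis by (simp add: residual_eq)
qed

lemma multiplier_minus_dual: "norm (w (Suc t) - z (Suc t)) \<le> norm (z (Suc t) - z t)"
proof -
  have "w (Suc t) - z (Suc t) = (1 - \<sigma>) *\<^sub>R (w (Suc t) - z t)"
    unfolding dual_step by (simp add: algebra_simps)
  then have "norm (w (Suc t) - z (Suc t)) = (\<sigma> - 1) * norm (w (Suc t) - z t)"
    using \<sigma> by simp
  also have "\<dots> \<le> \<sigma> * norm (w (Suc t) - z t)" by (intro mult_right_mono) auto
  also have "\<dots> = norm (z (Suc t) - z t)" unfolding dual_step using \<sigma> by simp
  finally show ?thesis .
qed

lemma dist_yb_le: "\<beta> t * norm (yb (Suc t) - y (Suc t)) \<le> \<tau> * Ch"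
proof -
  have "\<beta> t * norm (yb (Suc t) - y (Suc t)) = \<tau> * norm (w (Suc t))"
    using yb_eq[of t] penalty_pos[of t] \<tau>_ge_4 by simp
  also have "\<dots> \<le> \<tau> * Ch" using norm_multiplier_le \<tau>_ge_4 by (intro mult_left_mono) auto
  finally show ?thesis .
qed

end

section \<open>The step on the manifold\<close>

context oadmm_run
begin

text \<open>The subgradient of \<open>g\<close> chosen in step \<open>t\<close>.\<close>

definition v :: "nat \<Rightarrow> real ^ 'r ^ 'n" where
  "v t = (SOME v. v \<in> limiting_subdiff g (X t) \<and> is_arg_min
      (\<lambda>U. (U - X t) \<bullet> (gradient (\<lambda>U. aug_smooth f A U (y t) (z t) (\<beta> t)) (Xc t) - v)
        + \<theta> * L t / 2 * (norm (U - Xc t))\<^sup>2) (\<lambda>U. U \<in> stiefel) (X (Suc t)))"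

definition N :: "nat \<Rightarrow> real ^ 'r ^ 'n" where
  "N t = gradient f (Xc t) + adjoint A (z t + \<beta> t *\<^sub>R (A (Xc t) - y t))"

text \<open>The gradient of the quadratic model of step \<open>t\<close> at the current point \<open>X t\<close>, rather than at
  the extrapolated point \<open>Xc t\<close>.\<close>

definition D :: "nat \<Rightarrow> real ^ 'r ^ 'n" where
  "D t = N t - v t + (\<theta> * L t) *\<^sub>R (X t - Xc t)"

text \<open>The decrease of the model has two uses: the projected gradient at \<open>X t\<close> is bounded by it, and
  the descent of the augmented Lagrangian contains it.\<close>

definition gap :: "nat \<Rightarrow> real" where
  "gap t = - ((X (Suc t) - X t) \<bullet> D t + \<theta> * L t / 2 * (norm (X (Suc t) - X t))\<^sup>2)"

lemma
  shows v_subdiff: "v t \<in> limiting_subdiff g (X t)"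
    and X_argmin: "is_arg_min (\<lambda>U. (U - X t) \<bullet> (N t - v t) + \<theta> * L t / 2 * (norm (U - Xc t))\<^sup>2)
      (\<lambda>U. U \<in> stiefel) (X (Suc t))"
proof -
  have N: "gradient (\<lambda>U. aug_smooth f A U (y t) (z t) (\<beta> t)) (Xc t) = N t"
    unfolding N_def by (rule gradient_aug_smooth[OF lin f_diff])
  have "\<exists>v. v \<in> limiting_subdiff g (X t) \<and> is_arg_min
      (\<lambda>U. (U - X t) \<bullet> (N t - v) + \<theta> * L t / 2 * (norm (U - Xc t))\<^sup>2) (\<lambda>U. U \<in> stiefel) (X (Suc t))"
    using run_step(1)[of t] unfolding N by blast
  from someI_ex[OF this]
  show "v t \<in> limiting_subdiff g (X t)"
    and "is_arg_min (\<lambda>U. (U - X t) \<bullet> (N t - v t) + \<theta> * L t / 2 * (norm (U - Xc t))\<^sup>2)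
      (\<lambda>U. U \<in> stiefel) (X (Suc t))"
    unfolding v_def N by blast+
qed

lemma X_stiefel: "X t \<in> stiefel"
proof (cases t)
  case 0
  then show ?thesis using run by (simp add: oadmm_ep_def)
next
  case (Suc s)
  then show ?thesis using X_argmin[of s] by (simp add: is_arg_min_def)
qed

lemma v_subgradient: "g (X t) + v t \<bullet> (U - X t) \<le> g U"
  by (rule limiting_subgradient_convex[OF g_convex v_subdiff])

lemma norm_v_le: "norm (v t) \<le> Cg"
  using subgradient_norm_le_lipschitz[OF g_lip, of "X t" "v t" 0] v_subgradient by simp

lemma model_recentred:
  "(U - X t) \<bullet> (N t - v t) + \<theta> * L t / 2 * (norm (U - Xc t))\<^sup>2
    = (U - X t) \<bullet> D t + \<theta> * L t / 2 * (norm (U - X t))\<^sup>2 + \<theta> * L t / 2 * (norm (X t - Xc t))\<^sup>2"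
proof -
  have "U - Xc t = (U - X t) + (X t - Xc t)" by simp
  then have "(norm (U - Xc t))\<^sup>2
      = (norm (U - X t))\<^sup>2 + 2 * ((U - X t) \<bullet> (X t - Xc t)) + (norm (X t - Xc t))\<^sup>2"
    by (simp only: power2_norm_eq_inner inner_add_left inner_add_right inner_commute)
  then have "\<theta> * L t / 2 * (norm (U - Xc t))\<^sup>2 = \<theta> * L t / 2 * (norm (U - X t))\<^sup>2
      + \<theta> * L t * ((U - X t) \<bullet> (X t - Xc t)) + \<theta> * L t / 2 * (norm (X t - Xc t))\<^sup>2"
    by (simp only: distrib_left) simp
  moreover have "(U - X t) \<bullet> D t = (U - X t) \<bullet> (N t - v t) + \<theta> * L t * ((U - X t) \<bullet> (X t - Xc t))"
    by (simp only: D_def inner_add_right inner_scaleR_right)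
  ultimately show ?thesis by linarith
qed

lemma gap_bound:
  assumes "U \<in> stiefel"
  shows "- gap t \<le> (U - X t) \<bullet> D t + \<theta> * L t / 2 * (norm (U - X t))\<^sup>2"
  using X_argmin[of t] assms unfolding is_arg_min_linorder model_recentred gap_def
  by (auto simp: add.commute)

lemma gap_nonneg: "0 \<le> gap t"
  using gap_bound[OF X_stiefel, of t t] by simp

lemma penalty_term_expansion:
  "\<zeta> \<bullet> (A U - c) + b / 2 * (norm (A U - c))\<^sup>2
    = \<zeta> \<bullet> (A V - c) + b / 2 * (norm (A V - c))\<^sup>2
      + adjoint A (\<zeta> + b *\<^sub>R (A V - c)) \<bullet> (U - V) + b / 2 * (norm (A (U - V)))\<^sup>2"
proof -
  have "adjoint A (\<zeta> + b *\<^sub>R (A V - c)) \<bullet> (U - V) = (\<zeta> + b *\<^sub>R (A V - c)) \<bullet> (A U - A V)"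
    by (simp add: adjoint_clauses[OF lin] linear_diff[OF lin])
  then show ?thesis
    unfolding power2_norm_eq_inner linear_diff[OF lin]
    by (simp add: inner_commute algebra_simps)
qed

lemma L_split: "L t / 2 * x = \<beta> t * (onorm A)\<^sup>2 / 2 * x + Lf / 2 * x"
  by (simp add: L_def field_simps)

lemma smooth_part_upper:
  "aug_smooth f A U (y t) (z t) (\<beta> t)
    \<le> aug_smooth f A (Xc t) (y t) (z t) (\<beta> t) + N t \<bullet> (U - Xc t) + L t / 2 * (norm (U - Xc t))\<^sup>2"
proof -
  have "(norm (A (U - Xc t)))\<^sup>2 \<le> (onorm A * norm (U - Xc t))\<^sup>2"
    by (intro power_mono norm_linear_le_onorm lin) simp
  then have "\<beta> t / 2 * (norm (A (U - Xc t)))\<^sup>2 \<le> \<beta> t / 2 * (onorm A * norm (U - Xc t))\<^sup>2"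
    using penalty_pos[of t] by (intro mult_left_mono) auto
  also have "\<dots> = \<beta> t * (onorm A)\<^sup>2 / 2 * (norm (U - Xc t))\<^sup>2" by (simp add: power_mult_distrib)
  finally show ?thesis
    using lipschitz_gradient_upper[OF f_diff f_lip, of U "Xc t"]
      penalty_term_expansion[of "z t" U "y t" "\<beta> t" "Xc t"]
      L_split[of t "(norm (U - Xc t))\<^sup>2"]
    unfolding aug_smooth_def N_def inner_add_left[of "gradient f (Xc t)"] by linarith
qed

lemma smooth_part_lower:
  "aug_smooth f A (Xc t) (y t) (z t) (\<beta> t) + N t \<bullet> (U - Xc t) - L t / 2 * (norm (U - Xc t))\<^sup>2
    \<le> aug_smooth f A U (y t) (z t) (\<beta> t)"
proof -
  have "0 \<le> \<beta> t / 2 * (norm (A (U - Xc t)))\<^sup>2"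
    "0 \<le> \<beta> t * (onorm A)\<^sup>2 / 2 * (norm (U - Xc t))\<^sup>2"
    using penalty_pos[of t] by simp_all
  then show ?thesis
    using lipschitz_gradient_lower[OF f_diff f_lip, of "Xc t" U]
      penalty_term_expansion[of "z t" U "y t" "\<beta> t" "Xc t"]
      L_split[of t "(norm (U - Xc t))\<^sup>2"]
    unfolding aug_smooth_def N_def inner_add_left[of "gradient f (Xc t)"] by linarith
qed

definition d :: "nat \<Rightarrow> real" where "d s = norm (X (Suc s) - X s)"

text \<open>Twice the weight of the momentum term in the Lyapunov function.\<close>

definition momentum :: real where "momentum = (\<theta> - 1) * \<alpha> + 2 * \<alpha>\<^sup>2"

text \<open>Smoothness from above at the new point and from below at the old one, both around the
  extrapolated point, cost \<open>L / 2\<close> each; the curvature \<open>\<theta> L\<close> of the model with \<open>\<theta> > 1\<close> pays for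
  the first, and the second is a multiple of the previous step length.\<close>

lemma X_descent:
  defines "S \<equiv> \<lambda>s U. aug_smooth f A U (y (Suc s)) (z (Suc s)) (\<beta> (Suc s))"
  shows "S s (X (Suc (Suc s))) - g (X (Suc (Suc s))) \<le> S s (X (Suc s)) - g (X (Suc s)) - gap (Suc s)
    + L (Suc s) / 2 * (momentum * (d s)\<^sup>2 - (\<theta> - 1) * (1 - \<alpha>) * (d (Suc s))\<^sup>2)"
proof -
  let ?t = "Suc s" let ?X = "X (Suc s)" and ?X' = "X (Suc (Suc s))" and ?c = "Xc (Suc s)"
  define a b where "a = (norm (?X' - ?c))\<^sup>2" and "b = (norm (?X - ?c))\<^sup>2"
  have c: "?c = ?X + \<alpha> *\<^sub>R (?X - X s)" by (simp add: Xc_def)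
  have b: "b = \<alpha>\<^sup>2 * (d s)\<^sup>2" by (simp add: b_def c d_def power_mult_distrib)
  have a: "(1 - \<alpha>) * (d ?t)\<^sup>2 - (\<alpha> - \<alpha>\<^sup>2) * (d s)\<^sup>2 \<le> a"
  proof -
    define p q where "p = ?X' - ?X" and "q = ?X - X s"
    have "a = (norm (p - \<alpha> *\<^sub>R q))\<^sup>2" by (simp add: a_def c p_def q_def algebra_simps)
    also have "\<dots> = (1 - \<alpha>) * (norm p)\<^sup>2 - (\<alpha> - \<alpha>\<^sup>2) * (norm q)\<^sup>2 + \<alpha> * (norm (p - q))\<^sup>2"
      unfolding power2_norm_eq_inner
      by (simp add: inner_commute power2_eq_square algebra_simps)
    finally show ?thesis using \<alpha> by (simp add: d_def p_def q_def)
  qed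
  have "S s ?X' \<le> S s ?X + N ?t \<bullet> (?X' - ?X) + L ?t / 2 * a + L ?t / 2 * b"
    using smooth_part_upper[of ?X' ?t] smooth_part_lower[of ?t ?X]
    unfolding S_def a_def b_def by (simp add: inner_diff_right)
  moreover have "- g ?X' \<le> - g ?X - v ?t \<bullet> (?X' - ?X)"
    using v_subgradient[of ?t ?X'] by simp
  moreover have "N ?t \<bullet> (?X' - ?X) - v ?t \<bullet> (?X' - ?X) = - gap ?t + \<theta> * L ?t / 2 * b - \<theta> * L ?t / 2 * a"
  proof -
    have "N ?t \<bullet> (?X' - ?X) - v ?t \<bullet> (?X' - ?X) = (?X' - ?X) \<bullet> (N ?t - v ?t)"
      unfolding inner_diff_right[of _ "N ?t"] inner_commute[of _ "?X' - ?X"] ..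
    then show ?thesis
      using model_recentred[of ?X' ?t] unfolding gap_def a_def b_def by linarith
  qed
  ultimately have "S s ?X' - g ?X' \<le> S s ?X - g ?X - gap ?t + L ?t / 2 * ((\<theta> + 1) * b - (\<theta> - 1) * a)"
    by (simp add: algebra_simps add_divide_distrib diff_divide_distrib)
  also have "L ?t / 2 * ((\<theta> + 1) * b - (\<theta> - 1) * a)
      \<le> L ?t / 2 * (momentum * (d s)\<^sup>2 - (\<theta> - 1) * (1 - \<alpha>) * (d ?t)\<^sup>2)"
  proof (intro mult_left_mono)
    have "(\<theta> - 1) * ((1 - \<alpha>) * (d ?t)\<^sup>2 - (\<alpha> - \<alpha>\<^sup>2) * (d s)\<^sup>2) \<le> (\<theta> - 1) * a"
      using a \<theta> by (intro mult_left_mono) auto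
    then show "(\<theta> + 1) * b - (\<theta> - 1) * a \<le> momentum * (d s)\<^sup>2 - (\<theta> - 1) * (1 - \<alpha>) * (d ?t)\<^sup>2"
      by (simp add: b momentum_def algebra_simps)
  qed (simp add: L_nonneg)
  finally show ?thesis by simp
qed

text \<open>The bound on \<open>\<alpha>\<close> makes the momentum term at the next step, whose weight has grown by at
  most \<open>1 + \<xi>\<close>, strictly smaller than the decrease obtained at this one.\<close>

definition X_margin :: real where
  "X_margin = ((\<theta> - 1) * (1 - \<alpha>) - (1 + \<xi>) * momentum) / 2"

lemma X_margin_pos: "0 < X_margin"
proof -
  have den: "(\<theta> + 1) * (\<xi> + 2) > 0" using \<theta> \<xi> by simp
  have s: "\<alpha> * (\<xi> + 2) * (\<theta> + 1) < \<theta> - 1"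
    using \<alpha>(2) den by (simp add: pos_less_divide_eq mult_ac)
  have "\<alpha> * (1 + \<xi>) * (\<theta> + 1) \<le> \<alpha> * (\<xi> + 2) * (\<theta> + 1)"
    using \<alpha> \<theta> by (intro mult_right_mono mult_left_mono) auto
  with s have "\<alpha> * (1 + \<xi>) * (\<theta> + 1) \<le> \<theta> - 1" by linarith
  then have "(2 * \<alpha>) * (\<alpha> * (1 + \<xi>) * (\<theta> + 1)) \<le> (2 * \<alpha>) * (\<theta> - 1)"
    using \<alpha> by (intro mult_left_mono) auto
  moreover have "(\<theta> - 1) * (\<alpha> * (\<xi> + 2) * (\<theta> + 1)) \<le> (\<theta> - 1) * (\<theta> - 1)"
    using s \<theta> by (intro mult_left_mono) auto
  moreover have "0 < (\<theta> - 1) * (2 * (1 - \<alpha>))"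
    using \<theta> \<alpha>_less_1 by simp
  ultimately have "0 < (\<theta> + 1) * ((\<theta> - 1) * (1 - \<alpha>) - (1 + \<xi>) * momentum)"
    by (simp add: momentum_def power2_eq_square algebra_simps)
  then show ?thesis using \<theta> by (simp add: X_margin_def zero_less_mult_iff)
qed

lemma momentum_nonneg: "0 \<le> momentum"
  using \<alpha> \<theta> by (simp add: momentum_def)

end

section \<open>Descent in the splitting variable and control of the dual step\<close>

context oadmm_run
begin

text \<open>The gain is the growth of the joint objective in \<open>v\<close> and \<open>u\<close> around its minimiser, for the
  comparison pair \<open>(yb t, y t)\<close>; the weak convexity takes at most a quarter of the penalty.\<close>

lemma y_descent:
  "h (yb (Suc t)) + \<beta> t / (2 * \<tau>) * (norm (yb (Suc t) - y (Suc t)))\<^sup>2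
      + (z t \<bullet> (A (X (Suc t)) - y (Suc t)) + \<beta> t / 2 * (norm (A (X (Suc t)) - y (Suc t)))\<^sup>2)
      + 3 / 8 * \<beta> t * (norm (y (Suc t) - y t))\<^sup>2
    \<le> h (yb t) + \<beta> t / (2 * \<tau>) * (norm (yb t - y t))\<^sup>2
      + (z t \<bullet> (A (X (Suc t)) - y t) + \<beta> t / 2 * (norm (A (X (Suc t)) - y t))\<^sup>2)"
proof -
  define b where "b = A (X (Suc t)) + (1 / \<beta> t) *\<^sub>R z t"
  have bp: "\<beta> t > 0" by (rule penalty_pos)
  have sq: "\<beta> t / 2 * (norm (u - b))\<^sup>2 = z t \<bullet> (A (X (Suc t)) - u)
      + \<beta> t / 2 * (norm (A (X (Suc t)) - u))\<^sup>2 + (norm (z t))\<^sup>2 / (2 * \<beta> t)" for u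
  proof -
    have ub: "u - b = - ((A (X (Suc t)) - u) + (1 / \<beta> t) *\<^sub>R z t)" by (simp add: b_def)
    have "(norm (u - b))\<^sup>2 = (norm (A (X (Suc t)) - u))\<^sup>2
        + 2 / \<beta> t * (z t \<bullet> (A (X (Suc t)) - u)) + (norm (z t))\<^sup>2 / (\<beta> t)\<^sup>2"
      unfolding ub norm_minus_cancel power2_norm_eq_inner inner_add_left inner_add_right
      by (simp add: inner_commute power2_eq_square)
    then show ?thesis using bp by (simp add: distrib_left power2_eq_square)
  qed
  have \<mu>: "1 / (2 * (\<tau> / \<beta> t)) = \<beta> t / (2 * \<tau>)" by simp
  have "h (yb (Suc t)) + \<beta> t / (2 * \<tau>) * (norm (yb (Suc t) - y (Suc t)))\<^sup>2
      + \<beta> t / 2 * (norm (y (Suc t) - b))\<^sup>2 + (\<beta> t - 2 * Wh) / 2 * (norm (y t - y (Suc t)))\<^sup>2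
    \<le> h (yb t) + \<beta> t / (2 * \<tau>) * (norm (yb t - y t))\<^sup>2 + \<beta> t / 2 * (norm (y t - b))\<^sup>2"
    using prox_joint_growth[OF multiplier_subgradient yb_eq
        multiplier_conv_prox_center[of t, folded b_def] _ Wh weak_convexity_small(1), of "y t" "yb t"]
      bp \<tau>_ge_4 unfolding \<mu> by simp
  moreover have "3 / 8 * \<beta> t * (norm (y t - y (Suc t)))\<^sup>2 \<le> (\<beta> t - 2 * Wh) / 2 * (norm (y t - y (Suc t)))\<^sup>2"
    using weak_convexity_small(2)[of t] by (intro mult_right_mono) auto
  ultimately show ?thesis unfolding sq by (simp add: norm_minus_commute)
qed

definition u :: "nat \<Rightarrow> real" where "u s = (norm (z (Suc s) - z s))\<^sup>2"

lemma u_nonneg: "0 \<le> u s" by (simp add: u_def)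

lemma penalty_ratio_square_le:
  "(\<beta> (Suc s) / \<beta> s - 1)\<^sup>2 / \<beta> (Suc s) \<le> 1 / \<beta> s - 1 / \<beta> (Suc s)"
proof -
  have pos: "\<beta> s > 0" "\<beta> (Suc s) > 0" using penalty_pos by auto
  have "(\<beta> (Suc s) / \<beta> s - 1)\<^sup>2 \<le> \<beta> (Suc s) / \<beta> s - 1"
  proof -
    have "0 \<le> \<beta> (Suc s) / \<beta> s - 1" "\<beta> (Suc s) / \<beta> s - 1 \<le> 1"
      using pos penalty_mono[of s] penalty_double[of s] by (simp_all add: field_simps)
    then show ?thesis using mult_left_le[of "\<beta> (Suc s) / \<beta> s - 1" "\<beta> (Suc s) / \<beta> s - 1"]
      by (simp add: power2_eq_square)
  qed
  then have "(\<beta> (Suc s) / \<beta> s - 1)\<^sup>2 / \<beta> (Suc s) \<le> (\<beta> (Suc s) / \<beta> s - 1) / \<beta> (Suc s)"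
    using pos by (intro divide_right_mono) auto
  also have "\<dots> = 1 / \<beta> s - 1 / \<beta> (Suc s)" using pos by (simp add: diff_divide_distrib)
  finally show ?thesis .
qed

text \<open>The second term is caused by the change of the smoothing parameter. It telescopes because
  the penalty at most doubles in one step.\<close>

lemma multiplier_change_le:
  "(norm (w (Suc (Suc s)) - w (Suc s)))\<^sup>2 / \<beta> (Suc s)
    \<le> 2 * \<beta> (Suc s) / \<tau>\<^sup>2 * (norm (y (Suc (Suc s)) - y (Suc s)))\<^sup>2
      + 2 * Ch\<^sup>2 * (1 / \<beta> s - 1 / \<beta> (Suc s))"
proof -
  let ?b = "\<beta> s" and ?b' = "\<beta> (Suc s)"
  let ?dw = "norm (w (Suc (Suc s)) - w (Suc s))" and ?dy = "norm (y (Suc (Suc s)) - y (Suc s))"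
  have pos: "?b > 0" "?b' > 0" "\<tau> > 0" using penalty_pos \<tau>_ge_4 by auto
  have "\<tau> / ?b' * ?dw \<le> norm ((y (Suc (Suc s)) - y (Suc s)) - (\<tau> / ?b' - \<tau> / ?b) *\<^sub>R w (Suc s))"
    using pos by (intro prox_multiplier_lipschitz[OF multiplier_subgradient multiplier_subgradient
          yb_eq yb_eq _ Wh weak_convexity_small(1)]) auto
  also have "\<dots> \<le> ?dy + \<bar>\<tau> / ?b' - \<tau> / ?b\<bar> * norm (w (Suc s))"
    using norm_triangle_ineq4[of "y (Suc (Suc s)) - y (Suc s)"] by (metis norm_scaleR)
  also have "\<dots> \<le> ?dy + (\<tau> / ?b - \<tau> / ?b') * Ch"
  proof -
    have "\<tau> / ?b' \<le> \<tau> / ?b" using pos penalty_mono[of s] by (intro divide_left_mono) auto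
    then show ?thesis using norm_multiplier_le[of s] by (intro add_mono mult_mono) auto
  qed
  finally have "?b' / \<tau> * (\<tau> / ?b' * ?dw) \<le> ?b' / \<tau> * (?dy + (\<tau> / ?b - \<tau> / ?b') * Ch)"
    using pos by (intro mult_left_mono) auto
  then have "?dw \<le> ?b' / \<tau> * ?dy + (?b' / ?b - 1) * Ch"
    using pos by (simp add: distrib_left right_diff_distrib left_diff_distrib)
  then have "?dw\<^sup>2 \<le> (?b' / \<tau> * ?dy + (?b' / ?b - 1) * Ch)\<^sup>2"
    by (rule power_mono) simp
  also have "\<dots> \<le> 2 * (?b' / \<tau> * ?dy)\<^sup>2 + 2 * ((?b' / ?b - 1) * Ch)\<^sup>2"
    using sum_squares_bound[of "?b' / \<tau> * ?dy" "(?b' / ?b - 1) * Ch"] by (simp add: power2_sum)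
  finally have "?dw\<^sup>2 / ?b' \<le> (2 * (?b' / \<tau> * ?dy)\<^sup>2 + 2 * ((?b' / ?b - 1) * Ch)\<^sup>2) / ?b'"
    using pos by (intro divide_right_mono) auto
  also have "\<dots> = 2 * ?b' / \<tau>\<^sup>2 * ?dy\<^sup>2 + 2 * Ch\<^sup>2 * ((?b' / ?b - 1)\<^sup>2 / ?b')"
  proof -
    have "(?b' / \<tau> * ?dy)\<^sup>2 / ?b' = ?b' / \<tau>\<^sup>2 * ?dy\<^sup>2"
      using pos by (simp add: power2_eq_square)
    then show ?thesis by (simp add: add_divide_distrib power_mult_distrib mult_ac)
  qed
  also have "\<dots> \<le> 2 * ?b' / \<tau>\<^sup>2 * ?dy\<^sup>2 + 2 * Ch\<^sup>2 * (1 / ?b - 1 / ?b')"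
    using penalty_ratio_square_le by (intro add_left_mono mult_left_mono) auto
  finally show ?thesis .
qed

end

section \<open>The Lyapunov function\<close>

text \<open>Convexity of the squared norm, for the combination of \<open>- a\<close> and \<open>(\<sigma> / (1 - \<kappa>)) b\<close> with
  weights \<open>\<kappa>\<close> and \<open>1 - \<kappa>\<close>.\<close>

lemma norm_relaxed_step_square_le:
  fixes a b :: "'a::real_inner"
  assumes "0 \<le> \<kappa>" "\<kappa> < 1"
  shows "(norm (\<sigma> *\<^sub>R b - \<kappa> *\<^sub>R a))\<^sup>2 \<le> \<kappa> * (norm a)\<^sup>2 + \<sigma>\<^sup>2 / (1 - \<kappa>) * (norm b)\<^sup>2"
proof -
  define e where "e = (\<sigma> / (1 - \<kappa>)) *\<^sub>R b"
  have e: "\<sigma> *\<^sub>R b = (1 - \<kappa>) *\<^sub>R e" using assms by (simp add: e_def)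
  have "\<kappa> * (norm a)\<^sup>2 + (1 - \<kappa>) * (norm e)\<^sup>2 - (norm ((1 - \<kappa>) *\<^sub>R e - \<kappa> *\<^sub>R a))\<^sup>2
      = \<kappa> * (1 - \<kappa>) * (norm (e + a))\<^sup>2"
    unfolding power2_norm_eq_inner by (simp add: inner_commute power2_eq_square algebra_simps)
  moreover have "0 \<le> \<kappa> * (1 - \<kappa>) * (norm (e + a))\<^sup>2" using assms by simp
  moreover have "(1 - \<kappa>) * (norm e)\<^sup>2 = \<sigma>\<^sup>2 / (1 - \<kappa>) * (norm b)\<^sup>2"
    using assms by (simp add: e_def power_mult_distrib power_divide power2_eq_square)
  ultimately show ?thesis unfolding e by linarith
qed

text \<open>The inequality between geometric and arithmetic mean for the factors \<open>b * \<delta>\<close> and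
  \<open>l / \<delta>\<close>.\<close>

lemma le_weighted_sum_if_square_le:
  fixes x :: real
  assumes "x\<^sup>2 \<le> c * (b * l)" "0 \<le> c" "0 \<le> b" "0 \<le> l" "0 < \<delta>"
  shows "x \<le> (c + 1) * (b * \<delta> + l / \<delta>)"
proof -
  define P Q where "P = c * (b * \<delta>)" and "Q = l / \<delta>"
  have pos: "0 \<le> P" "0 \<le> Q" "0 \<le> b * \<delta>" using assms by (simp_all add: P_def Q_def)
  have "x\<^sup>2 \<le> P * Q" using assms by (simp add: P_def Q_def)
  also have "\<dots> \<le> (P + Q)\<^sup>2"
    using pos by (simp add: power2_sum)
  finally have "x \<le> P + Q"
    by (rule power2_le_imp_le) (use pos in simp)
  also have "\<dots> \<le> P + b * \<delta> + (c * Q + Q)"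
    using pos assms(2) by simp
  also have "\<dots> = (c + 1) * (b * \<delta> + l / \<delta>)"
    by (simp add: P_def Q_def algebra_simps add_divide_distrib)
  finally show ?thesis .
qed

context oadmm_run
begin

text \<open>The weights with which the squared dual change and the inverse penalties enter the
  Lyapunov function; each is the factor of a telescoping difference in one of the two
  following estimates.\<close>

definition dual_weight :: real where
  "dual_weight = 5 / 4 * (\<sigma> - 1) / (\<sigma> * (2 - \<sigma>))"

definition smoothing_weight :: real where
  "smoothing_weight = 5 / 2 * \<sigma> / (2 - \<sigma>)\<^sup>2 * Ch\<^sup>2"

definition parameter_weight :: real where
  "parameter_weight = 4 * Z\<^sup>2 + \<tau> * Ch\<^sup>2"

text \<open>The dual step raises the augmented Lagrangian by \<open>u / (\<sigma> \<beta>)\<close>. Consecutive dual changes obey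
  a contraction with factor \<open>\<sigma> - 1\<close>, driven by the change of the multiplier, which in turn is
  controlled by the change of \<open>y\<close>. Solving for \<open>u\<close> leaves a telescoping difference and a multiple
  of the change of \<open>y\<close> that the \<open>y\<close> step pays for: \<open>\<tau> (2 - \<sigma>) \<ge> 4\<close> gives \<open>5/16\<close>, below the \<open>3/8\<close>
  gained there. The factor \<open>5/4\<close> keeps a quarter of \<open>u / (\<sigma> \<beta>)\<close> as a loss.\<close>

lemma dual_change_le:
  "5 / 4 * (u (Suc s) / (\<sigma> * \<beta> (Suc s)))
    \<le> dual_weight * (u s / \<beta> (Suc s) - u (Suc s) / \<beta> (Suc (Suc s)))
      + 5 / 16 * \<beta> (Suc s) * (norm (y (Suc (Suc s)) - y (Suc s)))\<^sup>2
      + smoothing_weight * (1 / \<beta> s - 1 / \<beta> (Suc s))"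
proof -
  let ?b = "\<beta> (Suc s)" and ?b' = "\<beta> (Suc (Suc s))"
  let ?dw = "(norm (w (Suc (Suc s)) - w (Suc s)))\<^sup>2" and ?dy = "(norm (y (Suc (Suc s)) - y (Suc s)))\<^sup>2"
  have b: "?b > 0" by (rule penalty_pos)
  have \<sigma>': "\<sigma> > 0" "2 - \<sigma> > 0" using \<sigma> by auto
  have "z (Suc (Suc s)) - z (Suc s)
      = \<sigma> *\<^sub>R (w (Suc (Suc s)) - w (Suc s)) - (\<sigma> - 1) *\<^sub>R (z (Suc s) - z s)"
    using dual_step[of s] dual_step[of "Suc s"] by (simp add: algebra_simps)
  then have "u (Suc s) \<le> (\<sigma> - 1) * u s + \<sigma>\<^sup>2 / (2 - \<sigma>) * ?dw"
    using norm_relaxed_step_square_le[of "\<sigma> - 1" \<sigma> "w (Suc (Suc s)) - w (Suc s)" "z (Suc s) - z s"] \<sigma>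
    by (simp add: u_def)
  then have "(2 - \<sigma>) * u (Suc s) \<le> (\<sigma> - 1) * (u s - u (Suc s)) + \<sigma>\<^sup>2 / (2 - \<sigma>) * ?dw"
    by (simp add: algebra_simps)
  then have "5 / 4 / (\<sigma> * (2 - \<sigma>) * ?b) * ((2 - \<sigma>) * u (Suc s))
      \<le> 5 / 4 / (\<sigma> * (2 - \<sigma>) * ?b) * ((\<sigma> - 1) * (u s - u (Suc s)) + \<sigma>\<^sup>2 / (2 - \<sigma>) * ?dw)"
    using \<sigma>' b by (intro mult_left_mono) auto
  also have "5 / 4 / (\<sigma> * (2 - \<sigma>) * ?b) * ((2 - \<sigma>) * u (Suc s)) = 5 / 4 * (u (Suc s) / (\<sigma> * ?b))"
    using \<sigma>' by simp
  also have "5 / 4 / (\<sigma> * (2 - \<sigma>) * ?b) * ((\<sigma> - 1) * (u s - u (Suc s)) + \<sigma>\<^sup>2 / (2 - \<sigma>) * ?dw)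
      = dual_weight * (u s / ?b - u (Suc s) / ?b) + 5 / 4 * \<sigma> / (2 - \<sigma>)\<^sup>2 * (?dw / ?b)"
  proof -
    have "5 / 4 / (\<sigma> * \<rho> * ?b) * (\<kappa> * (u s - u (Suc s)) + \<sigma>\<^sup>2 / \<rho> * ?dw)
        = 5 / 4 * \<kappa> / (\<sigma> * \<rho>) * (u s / ?b - u (Suc s) / ?b) + 5 / 4 * \<sigma> / \<rho>\<^sup>2 * (?dw / ?b)"
      if "\<rho> > 0" for \<rho> \<kappa> :: real
      using \<sigma>' b that by (simp add: field_simps power2_eq_square)
    from this[OF \<sigma>'(2)] show ?thesis unfolding dual_weight_def .
  qed
  also have "dual_weight * (u s / ?b - u (Suc s) / ?b) \<le> dual_weight * (u s / ?b - u (Suc s) / ?b')"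
  proof (intro mult_left_mono diff_left_mono divide_left_mono)
    show "0 \<le> dual_weight" using \<sigma> by (simp add: dual_weight_def)
  qed (use penalty_mono u_nonneg penalty_pos in auto)
  also have "5 / 4 * \<sigma> / (2 - \<sigma>)\<^sup>2 * (?dw / ?b)
      \<le> 5 / 4 * \<sigma> / (2 - \<sigma>)\<^sup>2 * (2 * ?b / \<tau>\<^sup>2 * ?dy + 2 * Ch\<^sup>2 * (1 / \<beta> s - 1 / ?b))"
    using \<sigma>' by (intro mult_left_mono multiplier_change_le) auto
  also have "\<dots> = 5 / 2 * (\<sigma> / ((2 - \<sigma>)\<^sup>2 * \<tau>\<^sup>2)) * (?b * ?dy) + smoothing_weight * (1 / \<beta> s - 1 / ?b)"
    by (simp add: smoothing_weight_def distrib_left)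
  also have "5 / 2 * (\<sigma> / ((2 - \<sigma>)\<^sup>2 * \<tau>\<^sup>2)) * (?b * ?dy) \<le> 5 / 16 * (?b * ?dy)"
  proof (intro mult_right_mono)
    have "4 \<le> (2 - \<sigma>) * \<tau>" using \<tau> \<sigma>' by (simp add: pos_divide_le_eq mult.commute)
    then have "4\<^sup>2 \<le> ((2 - \<sigma>) * \<tau>)\<^sup>2" by (intro power_mono) auto
    then have "16 \<le> (2 - \<sigma>)\<^sup>2 * \<tau>\<^sup>2" by (simp add: power_mult_distrib)
    then have "\<sigma> / ((2 - \<sigma>)\<^sup>2 * \<tau>\<^sup>2) \<le> 2 / 16" using \<sigma> by (intro frac_le) auto
    then show "5 / 2 * (\<sigma> / ((2 - \<sigma>)\<^sup>2 * \<tau>\<^sup>2)) \<le> 5 / 16" by linarith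
  qed (use b in simp)
  finally show ?thesis by (simp add: mult.assoc)
qed

text \<open>The cost of raising the penalty, and with it of sharpening the envelope, between two
  iterations. Both residuals are of order \<open>1 / \<beta> t\<close> because \<open>z\<close> and \<open>w\<close> are bounded, so the cost
  telescopes.\<close>

lemma parameter_change_le:
  "(\<beta> (Suc t) - \<beta> t) / 2 * (norm (A (X (Suc t)) - y (Suc t)))\<^sup>2
      + (\<beta> (Suc t) - \<beta> t) / (2 * \<tau>) * (norm (yb (Suc t) - y (Suc t)))\<^sup>2
    \<le> parameter_weight * (1 / \<beta> t - 1 / \<beta> (Suc t))"
proof -
  let ?b = "\<beta> t" and ?b' = "\<beta> (Suc t)"
  let ?r = "norm (A (X (Suc t)) - y (Suc t))" and ?q = "norm (yb (Suc t) - y (Suc t))"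
  have pos: "?b > 0" "?b' > 0" "\<tau> > 0" using penalty_pos \<tau>_ge_4 by auto
  have "?b * ?r \<le> 2 * Z"
    using residual_le_dual_diff[of t] norm_dual_diff_le[of t] by linarith
  then have "(?b * ?r)\<^sup>2 \<le> (2 * Z)\<^sup>2" using pos by (intro power_mono) auto
  then have r: "?r\<^sup>2 \<le> 4 * Z\<^sup>2 / ?b\<^sup>2" using pos by (simp add: power_mult_distrib field_simps)
  have "(?b * ?q)\<^sup>2 \<le> (\<tau> * Ch)\<^sup>2" using pos by (intro power_mono dist_yb_le) auto
  then have q: "?q\<^sup>2 \<le> \<tau>\<^sup>2 * Ch\<^sup>2 / ?b\<^sup>2" using pos by (simp add: power_mult_distrib field_simps)
  have inc: "0 \<le> ?b' - ?b" using penalty_mono[of t] by simp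
  have "(?b' - ?b) / 2 * ?r\<^sup>2 + (?b' - ?b) / (2 * \<tau>) * ?q\<^sup>2
      \<le> (?b' - ?b) / 2 * (4 * Z\<^sup>2 / ?b\<^sup>2) + (?b' - ?b) / (2 * \<tau>) * (\<tau>\<^sup>2 * Ch\<^sup>2 / ?b\<^sup>2)"
    using inc pos by (intro add_mono mult_left_mono r q) auto
  also have "\<dots> = parameter_weight / 2 * ((?b' - ?b) / ?b\<^sup>2)"
    using pos by (simp add: parameter_weight_def power2_eq_square field_simps)
  also have "\<dots> \<le> parameter_weight / 2 * (2 * (1 / ?b - 1 / ?b'))"
  proof (intro mult_left_mono)
    have "(?b' - ?b) / ?b\<^sup>2 = (?b' - ?b) / ?b * (1 / ?b)" by (simp add: power2_eq_square)
    also have "\<dots> \<le> (?b' - ?b) / ?b * (2 / ?b')"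
      using inc pos penalty_double[of t] by (intro mult_left_mono) (auto simp: field_simps)
    also have "\<dots> = 2 * (1 / ?b - 1 / ?b')" using pos by (simp add: field_simps)
    finally show "(?b' - ?b) / ?b\<^sup>2 \<le> 2 * (1 / ?b - 1 / ?b')" .
  qed (use pos in \<open>simp add: parameter_weight_def\<close>)
  also have "\<dots> = parameter_weight * (1 / ?b - 1 / ?b')"
    unfolding mult.assoc[symmetric] by simp
  finally show ?thesis .
qed

text \<open>The augmented Lagrangian of the smoothed problem, with the Moreau envelope of \<open>h\<close> written
  through its proximal point \<open>yb\<close>. The multiplier relations hold from the first iterate on, so
  index \<open>s\<close> belongs to iterate \<open>Suc s\<close>, and \<open>loss s\<close> below to the step that leaves it.\<close>

definition aug_lagrangian :: "nat \<Rightarrow> real" where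
  "aug_lagrangian s = f (X (Suc s)) - g (X (Suc s)) + h (yb (Suc s))
    + \<beta> (Suc s) / (2 * \<tau>) * (norm (yb (Suc s) - y (Suc s)))\<^sup>2
    + (z (Suc s) \<bullet> (A (X (Suc s)) - y (Suc s))
       + \<beta> (Suc s) / 2 * (norm (A (X (Suc s)) - y (Suc s)))\<^sup>2)"

definition lyapunov :: "nat \<Rightarrow> real" where
  "lyapunov s = aug_lagrangian s + momentum / 2 * (L (Suc s) * (d s)\<^sup>2)
    + dual_weight * (u s / \<beta> (Suc s))
    + smoothing_weight / \<beta> s + parameter_weight / \<beta> (Suc s)"

definition loss :: "nat \<Rightarrow> real" where
  "loss s = gap (Suc s) + X_margin * (L (Suc s) * (d (Suc s))\<^sup>2) + u (Suc s) / (4 * \<sigma> * \<beta> (Suc s))"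

lemma aug_lagrangian_change:
  "aug_lagrangian (Suc s) \<le> aug_lagrangian s - gap (Suc s)
    + L (Suc s) / 2 * (momentum * (d s)\<^sup>2 - (\<theta> - 1) * (1 - \<alpha>) * (d (Suc s))\<^sup>2)
    - 3 / 8 * \<beta> (Suc s) * (norm (y (Suc (Suc s)) - y (Suc s)))\<^sup>2
    + u (Suc s) / (\<sigma> * \<beta> (Suc s))
    + parameter_weight * (1 / \<beta> (Suc s) - 1 / \<beta> (Suc (Suc s)))"
proof -
  let ?r = "A (X (Suc (Suc s))) - y (Suc (Suc s))" and ?q = "yb (Suc (Suc s)) - y (Suc (Suc s))"
  let ?b = "\<beta> (Suc s)" and ?b' = "\<beta> (Suc (Suc s))"
  have b: "?b > 0" by (rule penalty_pos)
  have dual: "z (Suc (Suc s)) \<bullet> ?r = z (Suc s) \<bullet> ?r + u (Suc s) / (\<sigma> * ?b)"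
  proof -
    have \<sigma>': "\<sigma> > 0" using \<sigma> by simp
    have r: "?r = (1 / (\<sigma> * ?b)) *\<^sub>R (z (Suc (Suc s)) - z (Suc s))"
      unfolding run_step(4)[of "Suc s"] using b \<sigma>' by simp
    have "(z (Suc (Suc s)) - z (Suc s)) \<bullet> ?r = u (Suc s) / (\<sigma> * ?b)"
      unfolding r u_def power2_norm_eq_inner by simp
    then show ?thesis by (simp add: inner_diff_left)
  qed
  have param: "?b' / 2 * (norm ?r)\<^sup>2 = ?b / 2 * (norm ?r)\<^sup>2 + (?b' - ?b) / 2 * (norm ?r)\<^sup>2"
    "?b' / (2 * \<tau>) * (norm ?q)\<^sup>2 = ?b / (2 * \<tau>) * (norm ?q)\<^sup>2 + (?b' - ?b) / (2 * \<tau>) * (norm ?q)\<^sup>2"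
    by (simp_all add: left_diff_distrib diff_divide_distrib)
  show ?thesis
    using X_descent[of s] y_descent[of "Suc s"] parameter_change_le[of "Suc s"]
    unfolding aug_lagrangian_def aug_smooth_def dual param by linarith
qed

lemma lyapunov_decrease: "lyapunov (Suc s) \<le> lyapunov s - loss s"
proof -
  have "momentum / 2 * (L (Suc (Suc s)) * (d (Suc s))\<^sup>2)
      \<le> momentum / 2 * ((1 + \<xi>) * L (Suc s) * (d (Suc s))\<^sup>2)"
    using momentum_nonneg by (intro mult_left_mono mult_right_mono L_ratio_le) auto
  then have "L (Suc s) / 2 * (momentum * (d s)\<^sup>2 - (\<theta> - 1) * (1 - \<alpha>) * (d (Suc s))\<^sup>2)
      + momentum / 2 * (L (Suc (Suc s)) * (d (Suc s))\<^sup>2)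
    \<le> momentum / 2 * (L (Suc s) * (d s)\<^sup>2) - X_margin * (L (Suc s) * (d (Suc s))\<^sup>2)"
    by (simp add: X_margin_def algebra_simps add_divide_distrib diff_divide_distrib)
  moreover have "5 / 16 * \<beta> (Suc s) * (norm (y (Suc (Suc s)) - y (Suc s)))\<^sup>2
      \<le> 3 / 8 * \<beta> (Suc s) * (norm (y (Suc (Suc s)) - y (Suc s)))\<^sup>2"
    using penalty_pos[of "Suc s"] by (intro mult_right_mono) auto
  moreover have "u (Suc s) / (4 * \<sigma> * \<beta> (Suc s)) = 1 / 4 * (u (Suc s) / (\<sigma> * \<beta> (Suc s)))"
    by simp
  moreover have "smoothing_weight * (1 / \<beta> s - 1 / \<beta> (Suc s))
      = smoothing_weight / \<beta> s - smoothing_weight / \<beta> (Suc s)"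
    "parameter_weight * (1 / \<beta> (Suc s) - 1 / \<beta> (Suc (Suc s)))
      = parameter_weight / \<beta> (Suc s) - parameter_weight / \<beta> (Suc (Suc s))"
    "dual_weight * (u s / \<beta> (Suc s) - u (Suc s) / \<beta> (Suc (Suc s)))
      = dual_weight * (u s / \<beta> (Suc s)) - dual_weight * (u (Suc s) / \<beta> (Suc (Suc s)))"
    by (simp_all add: right_diff_distrib)
  ultimately show ?thesis
    using aug_lagrangian_change[of s] dual_change_le[of s]
    unfolding lyapunov_def loss_def by linarith
qed

text \<open>The manifold is compact, and the multipliers, the residuals and hence \<open>yb\<close> stay bounded.\<close>

lemma lyapunov_bounded_below: "\<exists>m. \<forall>s. m \<le> lyapunov s"
proof -
  have "continuous_on UNIV f"
    using f_diff by (simp add: continuous_on_eq_continuous_within differentiable_imp_continuous_within)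
  moreover have "continuous_on UNIV g" using lipschitz_on_continuous_on[OF g_lip] .
  ultimately have "continuous_on stiefel (\<lambda>U. f U - g U)"
    by (intro continuous_intros) (auto intro: continuous_on_subset)
  then obtain U where U: "\<And>V. V \<in> stiefel \<Longrightarrow> f U - g U \<le> f V - g V"
    using continuous_attains_inf[OF compact_stiefel] X_stiefel by blast
  define \<rho> where "\<rho> = 2 * Z / \<beta>0"
  define R where "R = onorm A * sqrt (real CARD('r)) + \<rho> + \<tau> * Ch / \<beta>0"
  have "f U - g U + (h 0 - Ch * R) - Z * \<rho> \<le> lyapunov s" for s
  proof -
    have res: "norm (A (X (Suc s)) - y (Suc s)) \<le> \<rho>"
    proof -
      have "\<beta>0 * norm (A (X (Suc s)) - y (Suc s)) \<le> \<beta> s * norm (A (X (Suc s)) - y (Suc s))"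
        by (intro mult_right_mono penalty_ge) simp
      also have "\<dots> \<le> 2 * Z" using residual_le_dual_diff norm_dual_diff_le order_trans by blast
      finally show ?thesis using \<beta>0 by (simp add: \<rho>_def field_simps)
    qed
    have yy: "norm (yb (Suc s) - y (Suc s)) \<le> \<tau> * Ch / \<beta>0"
    proof -
      have "\<beta>0 * norm (yb (Suc s) - y (Suc s)) \<le> \<beta> s * norm (yb (Suc s) - y (Suc s))"
        by (intro mult_right_mono penalty_ge) simp
      also have "\<dots> \<le> \<tau> * Ch" by (rule dist_yb_le)
      finally show ?thesis using \<beta>0 by (simp add: field_simps)
    qed
    have "norm (A (X (Suc s))) \<le> onorm A * sqrt (real CARD('r))"
      using norm_linear_le_onorm[OF lin, of "X (Suc s)"] norm_stiefel[OF X_stiefel, of "Suc s"] by simp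
    moreover have "norm (yb (Suc s)) \<le> norm (A (X (Suc s)))
        + norm (A (X (Suc s)) - y (Suc s)) + norm (yb (Suc s) - y (Suc s))"
    proof -
      have "norm (a - b + c) \<le> norm a + norm b + norm c" for a b c :: "real ^ 'm"
        using norm_triangle_ineq[of "a - b" c] norm_triangle_ineq4[of a b] by linarith
      from this[of "A (X (Suc s))" "A (X (Suc s)) - y (Suc s)" "yb (Suc s) - y (Suc s)"]
      show ?thesis by simp
    qed
    ultimately have "norm (yb (Suc s)) \<le> R" unfolding R_def using res yy by linarith
    then have "Ch * norm (yb (Suc s)) \<le> Ch * R" using Ch_nonneg by (rule mult_left_mono)
    moreover have "h 0 - h (yb (Suc s)) \<le> Ch * norm (yb (Suc s))"
      using lipschitz_onD[OF h_lip, of 0 "yb (Suc s)"] by (simp add: dist_norm)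
    ultimately have hb: "h 0 - Ch * R \<le> h (yb (Suc s))" by linarith
    have "\<bar>z (Suc s) \<bullet> (A (X (Suc s)) - y (Suc s))\<bar> \<le> norm (z (Suc s)) * norm (A (X (Suc s)) - y (Suc s))"
      by (rule Cauchy_Schwarz_ineq2)
    also have "\<dots> \<le> Z * \<rho>" by (intro mult_mono norm_dual_le res Z_nonneg) simp
    finally have zr: "- (Z * \<rho>) \<le> z (Suc s) \<bullet> (A (X (Suc s)) - y (Suc s))" by linarith
    have "0 \<le> \<beta> (Suc s) / (2 * \<tau>) * (norm (yb (Suc s) - y (Suc s)))\<^sup>2"
      "0 \<le> \<beta> (Suc s) / 2 * (norm (A (X (Suc s)) - y (Suc s)))\<^sup>2"
      "0 \<le> momentum / 2 * (L (Suc s) * (d s)\<^sup>2)"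
      "0 \<le> dual_weight * (u s / \<beta> (Suc s))"
      "0 \<le> smoothing_weight / \<beta> s" "0 \<le> parameter_weight / \<beta> (Suc s)"
      using penalty_pos[of "Suc s"] penalty_pos[of s] \<tau>_ge_4 momentum_nonneg L_nonneg[of "Suc s"]
        u_nonneg[of s] \<sigma>
      by (simp_all add: dual_weight_def smoothing_weight_def parameter_weight_def)
    then show ?thesis
      using U[OF X_stiefel, of "Suc s"] hb zr unfolding lyapunov_def aug_lagrangian_def by linarith
  qed
  then show ?thesis by blast
qed

lemma loss_nonneg: "0 \<le> loss s"
  using gap_nonneg[of "Suc s"] X_margin_pos L_nonneg[of "Suc s"] u_nonneg[of "Suc s"] \<sigma> penalty_pos[of "Suc s"]
  by (simp add: loss_def)

lemma loss_sum_bounded: "\<exists>B. \<forall>n. (\<Sum>s<n. loss s) \<le> B"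
proof -
  obtain m where m: "\<And>s. m \<le> lyapunov s" using lyapunov_bounded_below by blast
  have "(\<Sum>s<n. loss s) \<le> lyapunov 0 - lyapunov n" for n
  proof (induction n)
    case (Suc n)
    then show ?case using lyapunov_decrease[of n] by simp
  qed simp
  then have "(\<Sum>s<n. loss s) \<le> lyapunov 0 - m" for n
    using m[of n] by (meson diff_left_mono order_trans)
  then show ?thesis by blast
qed

end

section \<open>The stationarity measure along the run\<close>

context oadmm_run
begin

text \<open>The tangential part of this vector enters the stationarity measure at \<open>X (Suc t)\<close>. A
  subgradient of \<open>g\<close> taken at \<open>X (Suc t)\<close> itself is needed, and the run provides one only in the
  step that leaves \<open>X (Suc t)\<close>; since \<open>g\<close> is not smooth, the subgradient of the step before cannot
  be transported there. So the comparison is with the model of the following step.\<close>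

definition residual_gradient :: "nat \<Rightarrow> real ^ 'r ^ 'n" where
  "residual_gradient t = gradient f (X (Suc t)) - v (Suc t) + adjoint A (z (Suc t))"



lemma residual_gradient_near_model:
  "norm (residual_gradient t - D (Suc t)) \<le> (1 + \<theta>) * (L (Suc t) * d t) + 2 * onorm A * norm (z (Suc t) - z t)"
proof -
  let ?X = "X (Suc t)" and ?c = "Xc (Suc t)" and ?b = "\<beta> (Suc t)"
  let ?e = "?b *\<^sub>R (A ?c - y (Suc t))"
  have b: "?b > 0" by (rule penalty_pos)

  have dist: "norm (?X - ?c) \<le> d t" "norm (?c - ?X) \<le> d t"
    using \<alpha> \<alpha>_less_1 by (simp_all add: Xc_def d_def mult_left_le_one_le)
  have lin_adj: "linear (adjoint A)" by (rule adjoint_linear[OF lin])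
  have "residual_gradient t - D (Suc t)
      = (gradient f ?X - gradient f ?c) - adjoint A ?e - (\<theta> * L (Suc t)) *\<^sub>R (?X - ?c)"
    unfolding residual_gradient_def D_def N_def linear_add[OF lin_adj] scaleR_diff_right[of "\<theta> * L (Suc t)"]
    by simp
  moreover have "norm (a - b - c) \<le> norm a + norm b + norm c" for a b c :: "real ^ 'r ^ 'n"
    using norm_triangle_ineq4[of "a - b" c] norm_triangle_ineq4[of a b] by linarith
  ultimately have "norm (residual_gradient t - D (Suc t))
      \<le> norm (gradient f ?X - gradient f ?c) + norm (adjoint A ?e) + norm ((\<theta> * L (Suc t)) *\<^sub>R (?X - ?c))"
    by (simp only:)
  also have "norm (gradient f ?X - gradient f ?c) \<le> Lf * d t"
    using lipschitz_onD[OF f_lip, of ?X ?c] mult_left_mono[OF dist(1) Lf_nonneg]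
    by (simp add: dist_norm)
  also have "norm ((\<theta> * L (Suc t)) *\<^sub>R (?X - ?c)) \<le> \<theta> * (L (Suc t) * d t)"
    using dist(1) L_nonneg[of "Suc t"] \<theta> by (simp add: mult.assoc mult_left_mono)
  also have "norm (adjoint A ?e) \<le> ?b * (onorm A)\<^sup>2 * d t + 2 * onorm A * norm (z (Suc t) - z t)"
  proof -
    have "A ?c - y (Suc t) = A (?c - ?X) + (A ?X - y (Suc t))"
      by (simp add: linear_diff[OF lin])
    then have "norm (A ?c - y (Suc t)) \<le> norm (A (?c - ?X)) + norm (A ?X - y (Suc t))"
      by (metis norm_triangle_ineq)
    also have "norm (A (?c - ?X)) \<le> onorm A * d t"
      using norm_linear_le_onorm[OF lin, of "?c - ?X"] mult_left_mono[OF dist(2) onorm_nonneg] by linarith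
    finally have "?b * norm (A ?c - y (Suc t)) \<le> ?b * (onorm A * d t + norm (A ?X - y (Suc t)))"
      using b by (intro mult_left_mono) auto
    moreover have "?b * norm (A ?X - y (Suc t)) \<le> 2 * norm (z (Suc t) - z t)"
      using residual_le_dual_diff[of t] mult_right_mono[OF penalty_double[of t], of "norm (A ?X - y (Suc t))"]
      by simp
    ultimately have "?b * norm (A ?c - y (Suc t)) \<le> ?b * onorm A * d t + 2 * norm (z (Suc t) - z t)"
      by (simp add: distrib_left mult.assoc)
    then have "onorm A * (?b * norm (A ?c - y (Suc t)))
        \<le> onorm A * (?b * onorm A * d t + 2 * norm (z (Suc t) - z t))"
      by (intro mult_left_mono onorm_nonneg)
    moreover have "norm (adjoint A ?e) \<le> onorm A * (?b * norm (A ?c - y (Suc t)))"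
      using norm_adjoint_le_onorm[OF lin, of ?e] b by simp
    ultimately show ?thesis by (simp add: distrib_left power2_eq_square mult_ac)
  qed
  finally show ?thesis by (simp add: L_def algebra_simps)
qed

text \<open>A bound on \<open>L t / \<beta> t\<close>.\<close>

definition L_ratio :: real where "L_ratio = (onorm A)\<^sup>2 + Lf / \<beta>0"

lemma L_le_penalty: "L t \<le> L_ratio * \<beta> t"
proof -
  have "Lf / \<beta>0 * \<beta>0 \<le> Lf / \<beta>0 * \<beta> t"
    using Lf_nonneg \<beta>0 by (intro mult_left_mono penalty_ge) auto
  then show ?thesis using \<beta>0 by (simp add: L_def L_ratio_def algebra_simps)
qed

lemma L_ratio_nonneg: "0 \<le> L_ratio"
  using Lf_nonneg \<beta>0 by (simp add: L_ratio_def)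

text \<open>The multiplier, the scaled residual and the step length are bounded, and \<open>L\<close> grows no faster
  than the penalty.\<close>

lemma model_gradient_le_penalty: "\<exists>K>0. \<forall>t. norm (D (Suc t)) + \<theta> * L (Suc t) \<le> K * \<beta> (Suc t)"
proof -
  define r where "r = 2 * sqrt (real CARD('r))"
  define c where "c = Cf + Cg + 5 * onorm A * Z"
  define K where "K = c / \<beta>0 + ((1 + \<theta>) * r + \<theta>) * L_ratio + 1"
  have "0 \<le> Cf" using f_grad[OF X_stiefel] norm_ge_zero order_trans by blast
  moreover have "0 \<le> Cg" using norm_v_le norm_ge_zero order_trans by blast
  ultimately have c: "0 \<le> c" using Z_nonneg onorm_nonneg by (simp add: c_def)
  have r: "0 \<le> r" by (simp add: r_def)
  have "norm (D (Suc t)) + \<theta> * L (Suc t) \<le> K * \<beta> (Suc t)" for t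
  proof -
    have "norm (residual_gradient t) \<le> norm (gradient f (X (Suc t))) + norm (v (Suc t))
        + norm (adjoint A (z (Suc t)))"
      unfolding residual_gradient_def
      using norm_triangle_ineq[of "gradient f (X (Suc t)) - v (Suc t)" "adjoint A (z (Suc t))"]
        norm_triangle_ineq4[of "gradient f (X (Suc t))" "v (Suc t)"] by linarith
    moreover have "norm (adjoint A (z (Suc t))) \<le> onorm A * Z"
      using norm_adjoint_le_onorm[OF lin, of "z (Suc t)"]
        mult_left_mono[OF norm_dual_le[of "Suc t"] onorm_nonneg] by linarith
    moreover have "norm (D (Suc t)) \<le> norm (residual_gradient t) + norm (residual_gradient t - D (Suc t))"
      using norm_triangle_ineq4[of "residual_gradient t" "residual_gradient t - D (Suc t)"] by simp
    moreover have "2 * onorm A * norm (z (Suc t) - z t) \<le> 2 * onorm A * (2 * Z)"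
      using norm_dual_diff_le onorm_nonneg by (intro mult_left_mono) auto
    moreover have "(1 + \<theta>) * (L (Suc t) * d t) \<le> (1 + \<theta>) * (L (Suc t) * r)"
    proof -
      have "d t \<le> r"
        using norm_triangle_ineq4[of "X (Suc t)" "X t"] norm_stiefel[OF X_stiefel, of t]
          norm_stiefel[OF X_stiefel, of "Suc t"] by (simp add: d_def r_def)
      then show ?thesis using \<theta> L_nonneg by (intro mult_left_mono) auto
    qed
    ultimately have "norm (D (Suc t)) + \<theta> * L (Suc t) \<le> c + ((1 + \<theta>) * r + \<theta>) * L (Suc t)"
      using f_grad[OF X_stiefel, of "Suc t"] norm_v_le[of "Suc t"] residual_gradient_near_model[of t]
      by (simp add: c_def algebra_simps)
    also have "c \<le> c / \<beta>0 * \<beta> (Suc t)"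
      using mult_left_mono[OF penalty_ge[of "Suc t"], of "c / \<beta>0"] c \<beta>0 by simp
    also have "((1 + \<theta>) * r + \<theta>) * L (Suc t) \<le> ((1 + \<theta>) * r + \<theta>) * (L_ratio * \<beta> (Suc t))"
      using \<theta> r by (intro mult_left_mono L_le_penalty) auto
    finally show ?thesis using penalty_pos[of "Suc t"] by (simp add: K_def algebra_simps)
  qed
  moreover have "K > 0"
  proof -
    have "0 \<le> c / \<beta>0" "0 \<le> ((1 + \<theta>) * r + \<theta>) * L_ratio" using c \<beta>0 \<theta> r L_ratio_nonneg by simp_all
    then show ?thesis unfolding K_def by linarith
  qed
  ultimately show ?thesis by blast
qed

text \<open>The witnesses are \<open>w\<close> for the subdifferential of \<open>h\<close> and \<open>v\<close> for that of \<open>g\<close>. The term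
  \<open>1 / \<beta> t\<close> is the smoothing error \<open>yb - y\<close>; the other terms are controlled by losses.\<close>

lemma Crit_le_components:
  "Crit f g h A (X (Suc t)) (yb (Suc t)) (z (Suc t))
    \<le> (1 / \<beta>0 + 1 + (1 + real CARD('r)) * (2 * onorm A)) * norm (z (Suc t) - z t)
      + \<tau> * Ch / \<beta> t
      + (1 + real CARD('r)) * (1 + \<theta>) * (L (Suc t) * d t)
      + norm (proj_tangent (X (Suc t)) (D (Suc t)))"
proof -
  let ?X = "X (Suc t)" and ?dz = "norm (z (Suc t) - z t)" and ?r = "1 + real CARD('r)"
  have "norm (A ?X - yb (Suc t)) \<le> norm (A ?X - y (Suc t)) + norm (yb (Suc t) - y (Suc t))"
    using norm_triangle_ineq4[of "A ?X - y (Suc t)" "yb (Suc t) - y (Suc t)"] by simp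
  also have "norm (A ?X - y (Suc t)) \<le> 1 / \<beta>0 * ?dz"
    using residual_le_dual_diff[of t] mult_right_mono[OF penalty_ge[of t], of "norm (A ?X - y (Suc t))"] \<beta>0
    by (simp add: field_simps)
  also have "norm (yb (Suc t) - y (Suc t)) \<le> \<tau> * Ch / \<beta> t"
    using dist_yb_le[of t] penalty_pos[of t] by (simp add: field_simps)
  finally have 1: "norm (A ?X - yb (Suc t)) \<le> 1 / \<beta>0 * ?dz + \<tau> * Ch / \<beta> t" by simp
  have "w (Suc t) \<in> limiting_subdiff h (yb (Suc t))"
    using multiplier_subgradient by (rule quadratic_minorant_in_limiting_subdiff)
  then have "set_norm ((\<lambda>q. q - z (Suc t)) ` limiting_subdiff h (yb (Suc t))) \<le> norm (w (Suc t) - z (Suc t))"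
    by (intro set_norm_le) simp
  then have 2: "set_norm ((\<lambda>q. q - z (Suc t)) ` limiting_subdiff h (yb (Suc t))) \<le> ?dz"
    using multiplier_minus_dual[of t] by linarith
  have "set_norm ((\<lambda>q. proj_tangent ?X (gradient f ?X - q + adjoint A (z (Suc t)))) ` limiting_subdiff g ?X)
      \<le> norm (proj_tangent ?X (residual_gradient t))"
    unfolding residual_gradient_def by (intro set_norm_le imageI v_subdiff)
  also have "proj_tangent ?X (residual_gradient t)
      = proj_tangent ?X (D (Suc t)) + proj_tangent ?X (residual_gradient t - D (Suc t))"
    by (simp flip: proj_tangent_add)
  also have "norm \<dots> \<le> norm (proj_tangent ?X (D (Suc t))) + ?r * norm (residual_gradient t - D (Suc t))"
    by (intro norm_triangle_mono norm_proj_tangent_le[OF X_stiefel] order_refl)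
  also have "?r * norm (residual_gradient t - D (Suc t))
      \<le> ?r * ((1 + \<theta>) * (L (Suc t) * d t) + 2 * onorm A * ?dz)"
    by (intro mult_left_mono residual_gradient_near_model) simp
  finally have "set_norm ((\<lambda>q. proj_tangent ?X (gradient f ?X - q + adjoint A (z (Suc t)))) ` limiting_subdiff g ?X)
      \<le> norm (proj_tangent ?X (D (Suc t))) + (?r * (1 + \<theta>) * (L (Suc t) * d t) + ?r * (2 * onorm A) * ?dz)"
    by (simp only: distrib_left[of ?r "(1 + \<theta>) * (L (Suc t) * d t)"] mult.assoc)
  moreover have "(1 / \<beta>0 + 1 + ?r * (2 * onorm A)) * ?dz = 1 / \<beta>0 * ?dz + ?dz + ?r * (2 * onorm A) * ?dz"
    by (simp only: distrib_right[of _ _ ?dz] mult_1_left)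
  ultimately show ?thesis
    using 1 2 unfolding Crit_def by linarith
qed

text \<open>Every term of the previous bound is, after squaring, at most \<open>\<beta> t\<close> times a loss of the
  Lyapunov function. The free parameter \<open>\<delta>\<close> balances the two factors.\<close>

lemma Crit_le_loss:
  "\<exists>K\<ge>0. \<forall>s \<delta>. \<delta> > 0 \<longrightarrow> Crit f g h A (X (Suc (Suc s))) (yb (Suc (Suc s))) (z (Suc (Suc s)))
    \<le> K * (1 / \<beta> (Suc s) + \<beta> (Suc s) * \<delta> + (loss s + loss (Suc s)) / \<delta>)"
proof -
  obtain M where "M > 0" and M: "\<And>t. norm (D (Suc t)) + \<theta> * L (Suc t) \<le> M * \<beta> (Suc t)"
    using model_gradient_le_penalty by blast
  let ?r = "real CARD('r)"
  define a1 a2 where "a1 = 1 / \<beta>0 + 1 + (1 + ?r) * (2 * onorm A)" and "a2 = (1 + ?r) * (1 + \<theta>)"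
  define c2 c3 where "c2 = 4 * L_ratio / X_margin" and "c3 = 64 * ?r ^ 5 * M"
  define K where "K = a1 * (8 + 1) + \<tau> * Ch + a2 * (c2 + 1) + (c3 + 1)"
  have a: "0 \<le> a1" "0 \<le> a2" using \<beta>0 onorm_nonneg \<theta> by (simp_all add: a1_def a2_def)
  have c: "0 \<le> c2" "0 \<le> c3" using L_ratio_nonneg X_margin_pos \<open>M > 0\<close> by (simp_all add: c2_def c3_def)
  have tc: "0 \<le> \<tau> * Ch" using \<tau>_ge_4 Ch_nonneg by simp
  have "Crit f g h A (X (Suc (Suc s))) (yb (Suc (Suc s))) (z (Suc (Suc s)))
      \<le> K * (1 / \<beta> (Suc s) + \<beta> (Suc s) * \<delta> + (loss s + loss (Suc s)) / \<delta>)" if \<delta>: "\<delta> > 0" for s \<delta>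
  proof -
    let ?t = "Suc s" and ?l = "loss s + loss (Suc s)"
    let ?Q = "1 / \<beta> ?t + \<beta> ?t * \<delta> + ?l / \<delta>"
    have b: "\<beta> ?t > 0" by (rule penalty_pos)
    have parts: "0 \<le> gap ?t" "0 \<le> gap (Suc ?t)" "0 \<le> X_margin * (L ?t * (d ?t)\<^sup>2)"
      "0 \<le> X_margin * (L (Suc ?t) * (d (Suc ?t))\<^sup>2)" "0 \<le> u ?t / (4 * \<sigma> * \<beta> ?t)"
      "0 \<le> u (Suc ?t) / (4 * \<sigma> * \<beta> (Suc ?t))"
      using gap_nonneg X_margin_pos L_nonneg u_nonneg \<sigma> penalty_pos[of "Suc ?t"] b by simp_all
    have loss: "u ?t / (4 * \<sigma> * \<beta> ?t) \<le> ?l" "X_margin * (L ?t * (d ?t)\<^sup>2) \<le> ?l" "gap (Suc ?t) \<le> ?l"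
      using parts unfolding loss_def by linarith+
    have l: "0 \<le> ?l" using loss_nonneg by simp
    have Q: "\<beta> ?t * \<delta> + ?l / \<delta> \<le> ?Q" "1 / \<beta> ?t \<le> ?Q" "0 \<le> ?Q"
      using b \<delta> l by simp_all
    have weighted: "x \<le> (e + 1) * ?Q" if "x\<^sup>2 \<le> e * (\<beta> ?t * ?l)" "0 \<le> e" for x e
    proof -
      have "x \<le> (e + 1) * (\<beta> ?t * \<delta> + ?l / \<delta>)"
        using le_weighted_sum_if_square_le[OF that _ l \<delta>] b by simp
      also have "\<dots> \<le> (e + 1) * ?Q" using that by (intro mult_left_mono Q) auto
      finally show ?thesis .
    qed
    have 1: "norm (z (Suc ?t) - z ?t) \<le> (8 + 1) * ?Q"
    proof (rule weighted)
      have "(norm (z (Suc ?t) - z ?t))\<^sup>2 = 4 * \<sigma> * \<beta> ?t * (u ?t / (4 * \<sigma> * \<beta> ?t))"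
        using b \<sigma> by (simp add: u_def)
      also have "\<dots> \<le> 4 * \<sigma> * \<beta> ?t * ?l" using b \<sigma> loss by (intro mult_left_mono) auto
      also have "\<dots> \<le> 8 * \<beta> ?t * ?l" using b \<sigma> l by (intro mult_right_mono) auto
      finally show "(norm (z (Suc ?t) - z ?t))\<^sup>2 \<le> 8 * (\<beta> ?t * ?l)" by (simp add: mult.assoc)
    qed simp
    have 2: "L (Suc ?t) * d ?t \<le> (c2 + 1) * ?Q"
    proof (rule weighted)
      have "L (Suc ?t) \<le> 2 * L ?t"
        using L_ratio_le[of ?t] mult_right_mono[of "1 + \<xi>" 2 "L ?t"] \<xi> L_nonneg by simp
      moreover have "L (Suc ?t) \<le> 2 * L_ratio * \<beta> ?t"
        using L_le_penalty[of "Suc ?t"] mult_left_mono[OF penalty_double[of ?t] L_ratio_nonneg] by simp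
      ultimately have "L (Suc ?t) * L (Suc ?t) \<le> (2 * L_ratio * \<beta> ?t) * (2 * L ?t)"
        using L_nonneg L_ratio_nonneg b by (intro mult_mono) auto
      then have "(L (Suc ?t) * L (Suc ?t)) * (d ?t)\<^sup>2 \<le> ((2 * L_ratio * \<beta> ?t) * (2 * L ?t)) * (d ?t)\<^sup>2"
        by (rule mult_right_mono) simp
      then have "(L (Suc ?t) * d ?t)\<^sup>2 \<le> c2 * \<beta> ?t * (X_margin * (L ?t * (d ?t)\<^sup>2))"
        using X_margin_pos by (simp add: c2_def power2_eq_square mult_ac)
      also have "\<dots> \<le> c2 * \<beta> ?t * ?l" using c b loss by (intro mult_left_mono) auto
      finally show "(L (Suc ?t) * d ?t)\<^sup>2 \<le> c2 * (\<beta> ?t * ?l)" by (simp add: mult.assoc)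
    qed (rule c)
    have 3: "norm (proj_tangent (X (Suc ?t)) (D (Suc ?t))) \<le> (c3 + 1) * ?Q"
    proof (rule weighted)
      have "(norm (proj_tangent (X (Suc ?t)) (D (Suc ?t))))\<^sup>2
          \<le> 32 * ?r ^ 5 * (M * \<beta> (Suc ?t) * gap (Suc ?t))"
        using M[of ?t] \<theta> L_nonneg[of "Suc ?t"] \<open>M > 0\<close> penalty_pos[of "Suc ?t"]
        by (intro norm_proj_tangent_le_decrease[OF X_stiefel _ _ _ gap_bound]) auto
      also have "\<dots> \<le> 32 * ?r ^ 5 * (M * (2 * \<beta> ?t) * ?l)"
        using \<open>M > 0\<close> penalty_double b loss(3) gap_nonneg by (intro mult_left_mono mult_mono) auto
      finally show "(norm (proj_tangent (X (Suc ?t)) (D (Suc ?t))))\<^sup>2 \<le> c3 * (\<beta> ?t * ?l)"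
        by (simp add: c3_def mult_ac)
    qed (rule c)
    have "Crit f g h A (X (Suc ?t)) (yb (Suc ?t)) (z (Suc ?t))
        \<le> a1 * norm (z (Suc ?t) - z ?t) + \<tau> * Ch * (1 / \<beta> ?t) + a2 * (L (Suc ?t) * d ?t)
          + norm (proj_tangent (X (Suc ?t)) (D (Suc ?t)))"
      using Crit_le_components[of ?t] by (simp add: a1_def a2_def)
    also have "\<dots> \<le> a1 * ((8 + 1) * ?Q) + \<tau> * Ch * ?Q + a2 * ((c2 + 1) * ?Q) + (c3 + 1) * ?Q"
      by (intro add_mono mult_left_mono 1 2 3 Q a tc)
    also have "\<dots> = K * ?Q" by (simp only: K_def distrib_right mult.assoc)
    finally show ?thesis .
  qed
  moreover have "0 \<le> K" using a c tc by (simp add: K_def)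
  ultimately show ?thesis by blast
qed

text \<open>With \<open>\<delta> = T powr (-2/3)\<close> all three contributions are of order \<open>T powr (2/3)\<close>: the smoothing
  errors sum like \<open>t powr (-1/3)\<close>, the terms \<open>\<beta> t * \<delta>\<close> are at most of order \<open>T powr (-1/3)\<close> each,
  and the losses have a bounded sum. For a general exponent \<open>p\<close> the smoothing errors sum to order
  \<open>T powr (1 - p)\<close> and the rest to \<open>T powr ((1 + p) / 2)\<close>; these agree for \<open>p = 1/3\<close>.\<close>

lemma Crit_sum_le:
  assumes p3: "p = 1 / 3"
  shows "\<exists>C\<ge>0. \<forall>T\<ge>1. (\<Sum>t = 1..T. Crit f g h A (X (t + 1)) (yb (t + 1)) (z (t + 1)))
    \<le> C * real T powr (2 / 3)"
proof -
  obtain K where "K \<ge> 0" and K: "\<And>s \<delta>. \<delta> > 0 \<Longrightarrow>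
      Crit f g h A (X (Suc (Suc s))) (yb (Suc (Suc s))) (z (Suc (Suc s)))
      \<le> K * (1 / \<beta> (Suc s) + \<beta> (Suc s) * \<delta> + (loss s + loss (Suc s)) / \<delta>)"
    using Crit_le_loss by blast
  obtain B where B: "\<And>n. (\<Sum>s<n. loss s) \<le> B" using loss_sum_bounded by blast
  have B0: "0 \<le> B" using B[of 0] by simp
  define C where "C = K * (2 / (\<beta>0 * \<xi>) + 2 * \<beta>0 + 2 * B)"
  have "(\<Sum>t = 1..T. Crit f g h A (X (t + 1)) (yb (t + 1)) (z (t + 1))) \<le> C * real T powr (2 / 3)"
    if "T \<ge> 1" for T
  proof -
    have T: "real T \<ge> 1" using that by simp
    define \<delta> where "\<delta> = real T powr (- (2 / 3))"
    have \<delta>: "\<delta> > 0" using T by (simp add: \<delta>_def)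
    have inv\<delta>: "1 / \<delta> = real T powr (2 / 3)" by (simp add: \<delta>_def powr_minus_divide)
    have inv_pen: "1 / \<beta> t \<le> 1 / (\<beta>0 * \<xi>) * real t powr (- 1 / 3)" if "t \<ge> 1" for t
    proof -
      have "real t powr (1 / 3) > 0" using that by simp
      then have "1 / \<beta> t \<le> 1 / (\<beta>0 * (\<xi> * real t powr (1 / 3)))"
        using \<beta>0 \<xi> by (intro divide_left_mono) (auto simp: penalty_def p3 add_pos_pos)
      then show ?thesis by (simp add: powr_minus_divide)
    qed
    have pen: "\<beta> t * \<delta> \<le> 2 * \<beta>0 * real T powr (- 1 / 3)" if "t \<le> T" for t
    proof -
      have "real t powr (1 / 3) \<le> real T powr (1 / 3)" using that by (intro powr_mono2) auto
      then have "\<xi> * real t powr (1 / 3) \<le> 1 * real T powr (1 / 3)" using \<xi> by (intro mult_mono) auto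
      moreover have "1 \<le> real T powr (1 / 3)" using T by (intro ge_one_powr_ge_zero) auto
      ultimately have "1 + \<xi> * real t powr (1 / 3) \<le> 2 * real T powr (1 / 3)" by linarith
      then have "\<beta> t \<le> \<beta>0 * (2 * real T powr (1 / 3))"
        unfolding penalty_def p3 using \<beta>0 by (intro mult_left_mono) auto
      then have "\<beta> t * \<delta> \<le> \<beta>0 * (2 * real T powr (1 / 3)) * \<delta>"
        using \<delta> by (intro mult_right_mono) auto
      also have "\<dots> = 2 * \<beta>0 * (real T powr (1 / 3) * \<delta>)" by simp
      also have "real T powr (1 / 3) * \<delta> = real T powr (- 1 / 3)"
        by (simp add: \<delta>_def flip: powr_add)
      finally show ?thesis .
    qed
    have "(\<Sum>t = 1..T. Crit f g h A (X (t + 1)) (yb (t + 1)) (z (t + 1)))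
        \<le> (\<Sum>t = 1..T. K * (1 / (\<beta>0 * \<xi>) * real t powr (- 1 / 3) + 2 * \<beta>0 * real T powr (- 1 / 3)
          + (loss (t - 1) + loss t) / \<delta>))"
    proof (rule sum_mono)
      fix t assume t: "t \<in> {1..T}"
      then obtain s where s: "t = Suc s" by (cases t) auto
      have "Crit f g h A (X (t + 1)) (yb (t + 1)) (z (t + 1))
          \<le> K * (1 / \<beta> t + \<beta> t * \<delta> + (loss (t - 1) + loss t) / \<delta>)"
        using K[OF \<delta>, of s] by (simp add: s)
      also have "\<dots> \<le> K * (1 / (\<beta>0 * \<xi>) * real t powr (- 1 / 3) + 2 * \<beta>0 * real T powr (- 1 / 3)
          + (loss (t - 1) + loss t) / \<delta>)"
        using t by (intro mult_left_mono add_mono inv_pen pen \<open>K \<ge> 0\<close> order_refl) auto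
      finally show "Crit f g h A (X (t + 1)) (yb (t + 1)) (z (t + 1)) \<le> \<dots>" .
    qed
    also have "\<dots> = K * (1 / (\<beta>0 * \<xi>) * (\<Sum>t = 1..T. real t powr (- 1 / 3))
        + 2 * \<beta>0 * (real T * real T powr (- 1 / 3))
        + ((\<Sum>t = 1..T. loss (t - 1)) + (\<Sum>t = 1..T. loss t)) * (1 / \<delta>))"
      by (simp add: sum.distrib add_divide_distrib flip: sum_distrib_left sum_divide_distrib)
    also have "\<dots> \<le> K * (1 / (\<beta>0 * \<xi>) * (2 * real T powr (2 / 3))
        + 2 * \<beta>0 * real T powr (2 / 3) + (B + B) * real T powr (2 / 3))"
    proof (intro mult_left_mono[OF _ \<open>K \<ge> 0\<close>] add_mono)
      show "1 / (\<beta>0 * \<xi>) * (\<Sum>t = 1..T. real t powr (- 1 / 3)) \<le> 1 / (\<beta>0 * \<xi>) * (2 * real T powr (2 / 3))"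
        using \<beta>0 \<xi> by (intro mult_left_mono sum_powr_neg_third_le) auto
      have "real T * real T powr (- 1 / 3) = real T powr (2 / 3)"
        using T powr_mult_base[of "real T" "- 1 / 3"] by simp
      then show "2 * \<beta>0 * (real T * real T powr (- 1 / 3)) \<le> 2 * \<beta>0 * real T powr (2 / 3)" by simp
      have "(\<Sum>t = 1..T. loss (t - 1)) = (\<Sum>s<T. loss s)"
        by (rule sum.reindex_bij_witness[of _ Suc "\<lambda>t. t - 1"]) auto
      moreover have "(\<Sum>t = 1..T. loss t) \<le> (\<Sum>s<Suc T. loss s)"
        by (rule sum_mono2) (auto simp: loss_nonneg)
      ultimately have "(\<Sum>t = 1..T. loss (t - 1)) + (\<Sum>t = 1..T. loss t) \<le> B + B"
        using B[of T] B[of "Suc T"] by linarith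
      then show "((\<Sum>t = 1..T. loss (t - 1)) + (\<Sum>t = 1..T. loss t)) * (1 / \<delta>) \<le> (B + B) * real T powr (2 / 3)"
        unfolding inv\<delta> by (rule mult_right_mono) simp
    qed
    also have "\<dots> = C * real T powr (2 / 3)" by (simp add: C_def algebra_simps)
    finally show ?thesis .
  qed
  moreover have "0 \<le> C" using \<open>K \<ge> 0\<close> \<beta>0 \<xi> B0 by (simp add: C_def)
  ultimately show ?thesis by blast
qed

end

section \<open>From the average to the best iterate\<close>

text \<open>An average of at most \<open>\<epsilon>\<close> forces some term to be at most \<open>\<epsilon>\<close>. Taking \<open>(C + 1) ^ 3\<close> instead
  of \<open>C ^ 3\<close> makes the constant positive, so that the hypothesis on \<open>T\<close> excludes \<open>T = 0\<close>.\<close>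

lemma cube_root_rate_imp_complexity:
  fixes F :: "nat \<Rightarrow> real"
  assumes avg: "\<And>T. T \<ge> 1 \<Longrightarrow> 1 / real T * (\<Sum>t = 1..T. F t) \<le> C * real T powr (- 1 / 3)" and "C \<ge> 0"
  shows "\<exists>C'>0. \<forall>\<epsilon>>0. \<forall>T::nat. real T \<ge> C' / \<epsilon> ^ 3 \<longrightarrow> (\<exists>t\<in>{1..T}. F t \<le> \<epsilon>)"
proof (intro exI[of _ "(C + 1) ^ 3"] conjI allI impI)
  show "(C + 1) ^ 3 > 0" using \<open>C \<ge> 0\<close> by simp
  fix \<epsilon> :: real and T :: nat
  assume \<epsilon>: "\<epsilon> > 0" and T: "real T \<ge> (C + 1) ^ 3 / \<epsilon> ^ 3"
  have "(C + 1) ^ 3 / \<epsilon> ^ 3 > 0" using \<epsilon> \<open>C \<ge> 0\<close> by simp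
  then have T0: "real T > 0" using T by linarith
  then have T1: "T \<ge> 1" by simp
  define a where "a = real T powr (1 / 3)"
  have a: "a > 0" "a ^ 3 = real T" using T0 by (simp_all add: a_def powr_power)
  have "((C + 1) / \<epsilon>) ^ 3 \<le> a ^ 3" using T by (simp add: a power_divide)
  then have "(C + 1) / \<epsilon> \<le> a" by (rule power_le_imp_le_base[where n = 2, simplified]) (use a in simp)
  then have "C / a \<le> \<epsilon>" using \<epsilon> a by (simp add: field_simps)
  have "1 / real T * (\<Sum>t = 1..T. F t) \<le> C / a"
    using avg[OF T1] by (simp add: a_def powr_minus_divide)
  also have "\<dots> \<le> \<epsilon>" by fact
  finally have sum: "(\<Sum>t = 1..T. F t) \<le> real T * \<epsilon>" using T0 by (simp add: field_simps)
  show "\<exists>t\<in>{1..T}. F t \<le> \<epsilon>"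
  proof (rule ccontr)
    assume "\<not> ?thesis"
    then have "(\<Sum>t = 1..T. \<epsilon>) < (\<Sum>t = 1..T. F t)"
      using T1 by (intro sum_strict_mono) (auto simp: not_le)
    with sum show False by simp
  qed
qed

theorem theorem4p8:
  fixes f g :: "real ^ 'r ^ 'n \<Rightarrow> real"
    and h :: "real ^ 'm \<Rightarrow> real"
    and A :: "real ^ 'r ^ 'n \<Rightarrow> real ^ 'm"
    and Lf Cf Cg Ch Wh p \<xi> \<theta> \<sigma> \<tau> \<beta>0 \<alpha> :: real
    and X :: "nat \<Rightarrow> real ^ 'r ^ 'n"
    and y yb z :: "nat \<Rightarrow> real ^ 'm"
  assumes "CARD('r) \<le> CARD('n)"
    and "linear A"
    and "\<And>U. f differentiable (at U)"
    and "Lf-lipschitz_on UNIV (gradient f)"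
    and "\<And>U. U \<in> stiefel \<Longrightarrow> norm (gradient f U) \<le> Cf"
    and "convex_on UNIV g"
    and "Cg-lipschitz_on UNIV g"
    and "Ch-lipschitz_on UNIV h"
    and "Wh \<ge> 0"
    and "weakly_convex Wh h"
    and "0 < p" "p < 1"
    and "0 < \<xi>" "\<xi> < 1"
    and "\<theta> > 1"
    and "1 \<le> \<sigma>" "\<sigma> < 2"
    and "\<tau> \<ge> 4 / (2 - \<sigma>)"
    and "\<beta>0 > 0"
    and "\<beta>0 \<ge> 2 * \<tau> * Wh"
    and "0 \<le> \<alpha>" "\<alpha> < (\<theta> - 1) / ((\<theta> + 1) * (\<xi> + 2))"
    and "oadmm_ep f g h A Lf p \<xi> \<theta> \<sigma> \<tau> \<beta>0 \<alpha> X y yb z"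
    and "p = 1/3"
  shows "(\<exists>C. \<forall>T::nat. T \<ge> 1 \<longrightarrow>
            (1 / real T) * (\<Sum>t = 1..T. Crit f g h A (X (t + 1)) (yb (t + 1)) (z (t + 1)))
              \<le> C * real T powr (-1/3)) \<and>
         (\<exists>C'>0. \<forall>\<epsilon>>0. \<forall>T::nat. real T \<ge> C' / \<epsilon> ^ 3 \<longrightarrow>
            (\<exists>t\<in>{1..T}. Crit f g h A (X (t + 1)) (yb (t + 1)) (z (t + 1)) \<le> \<epsilon>))"
proof -
  interpret oadmm_run f g h A Lf Cf Cg Ch Wh p \<xi> \<theta> \<sigma> \<tau> \<beta>0 \<alpha> X y yb z
    by (rule oadmm_run.intro) (fact assms)+
  let ?F = "\<lambda>t. Crit f g h A (X (t + 1)) (yb (t + 1)) (z (t + 1))"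
  obtain C where "C \<ge> 0" and C: "\<And>T. T \<ge> 1 \<Longrightarrow> (\<Sum>t = 1..T. ?F t) \<le> C * real T powr (2 / 3)"
    using Crit_sum_le[OF assms(24)] by blast
  have avg: "1 / real T * (\<Sum>t = 1..T. ?F t) \<le> C * real T powr (- 1 / 3)" if "T \<ge> 1" for T
  proof -
    have T: "real T > 0" using that by simp
    have "1 / real T * (\<Sum>t = 1..T. ?F t) \<le> 1 / real T * (C * real T powr (2 / 3))"
      by (intro mult_left_mono C that) simp
    also have "\<dots> = C * (real T powr (2 / 3) / real T powr 1)" using T by simp
    also have "real T powr (2 / 3) / real T powr 1 = real T powr (- 1 / 3)"
      unfolding powr_diff[symmetric] by simp
    finally show ?thesis .
  qed
  with cube_root_rate_imp_complexity[OF avg \<open>C \<ge> 0\<close>] show ?thesis by blast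
qed

end
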